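(* For a polytope $P\subset\mathbb{R}^d$ and $c\in\mathbb{R}^d$ let $L_{(P,c)}(t)=\#((c+tP)\cap\mathbb{Z}^d)$ for $t\in\mathbb{Z}_{>0}$. (1) If $P\subset\mathbb{R}^d$ is a lattice polytope of dimension $d$ and $c\in\mathbb{R}^d$, then $L_{(P,c)}(t)\in\mathbb{Q}[t]$, i.e. it is given for all $t\in\mathbb{Z}_{>0}$ by a polynomial in $t$ with rational coefficients. Furthermore, $\deg L_{(P,c)}(t)=d$ and the leading coefficient of $L_{(P,c)}(t)$ is $\operatorname{relvol}(P)$. (2) Let $P\subset\mathbb{R}^d$ be a lattice polytope (not necessarily of dimension $d$) and $c\in\mathbb{R}^d$. Then $L_{(P,c)}(t)\in\mathbb{Q}[t]$. Furthermore, if $L_{(P,c)}(t)\neq 0$ (as a polynomial), then it is a polynomial of degree $\dim P$ with leading coefficient $\operatorname{relvol}(P)$.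
   Context: A polytope is the convex hull of finitely many points of $\mathbb{R}^d$ (at least one point); it is a lattice polytope if all its vertices lie in $\mathbb{Z}^d$. Its dimension is the dimension of its affine hull $\operatorname{aff}(P)$. If $P$ is a lattice polytope of dimension $m$, then $\operatorname{aff}(P)\cap\mathbb{Z}^d\simeq\mathbb{Z}^m$, and the relative volume $\operatorname{relvol}(P)$ is the $m$-dimensional volume of $P$ rescaled so that the unit cube (a fundamental parallelepiped) of the lattice $\operatorname{aff}(P)\cap\mathbb{Z}^d\simeq\mathbb{Z}^m$ has volume $1$; in particular $\operatorname{relvol}(P)$ is the Euclidean volume if $m=d$, and equals $1$ if $m=0$. *)

theory Defs
  imports "HOL-Analysis.Analysis" "HOL-Computational_Algebra.Polynomial"
begin

definition int_points :: "(real ^ 'n) set" where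
  "int_points = {x. \<forall>i. x $ i \<in> \<int>}"

text \<open>The library's \<^const>\<open>polytope\<close> admits the empty set, which is excluded here. The vertices
  of a polytope are its extreme points.\<close>

definition lattice_polytope :: "(real ^ 'n) set \<Rightarrow> bool" where
  "lattice_polytope P \<longleftrightarrow> polytope P \<and> P \<noteq> {} \<and> (\<forall>v. v extreme_point_of P \<longrightarrow> v \<in> int_points)"

definition lattice_count :: "(real ^ 'n) set \<Rightarrow> real ^ 'n \<Rightarrow> nat \<Rightarrow> nat" where
  "lattice_count P c t = card ((\<lambda>x. c + real t *\<^sub>R x) ` P \<inter> int_points)"

definition direction_space :: "'a::real_vector set \<Rightarrow> 'a set" where
  "direction_space S = {x - y | x y. x \<in> affine hull S \<and> y \<in> affine hull S}"

definition orthonormal_basis_of :: "'a::euclidean_space set \<Rightarrow> 'a set \<Rightarrow> bool" where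
  "orthonormal_basis_of V B \<longleftrightarrow> pairwise orthogonal B \<and> (\<forall>b\<in>B. norm b = 1) \<and> span B = V"

text \<open>Lebesgue measure on \<open>span B\<close>, for orthonormal \<open>B\<close>, viewed as a measure on the ambient space;
  for \<open>B = Basis\<close> it is \<^const>\<open>lborel\<close>, and for \<open>B = {}\<close> the unit mass at the origin.\<close>

definition span_lborel :: "'a::euclidean_space set \<Rightarrow> 'a measure" where
  "span_lborel B = distr (\<Pi>\<^sub>M b\<in>B. lborel) borel (\<lambda>f. \<Sum>b\<in>B. f b *\<^sub>R b)"

text \<open>The \<open>m\<close>-dimensional volume of a nonempty Borel set \<open>S\<close>, where \<open>m\<close> is the dimension of its
  affine hull. By rotation and translation invariance of Lebesgue measure, the choices of the
  orthonormal basis \<open>B\<close> and of the origin \<open>a\<close> do not matter.\<close>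

definition affine_volume :: "'a::euclidean_space set \<Rightarrow> real" where
  "affine_volume S =
    (let B = (SOME B. orthonormal_basis_of (direction_space S) B);
         a = (SOME a. a \<in> affine hull S)
     in measure (span_lborel B) ((\<lambda>x. x - a) ` S))"

text \<open>The affine lattice \<open>affine hull P \<inter> int_points\<close> is represented by its lattice of differences,
  of which \<open>C\<close> is a basis over the integers.\<close>

definition lattice_basis_of :: "(real ^ 'n) set \<Rightarrow> (real ^ 'n) set \<Rightarrow> bool" where
  "lattice_basis_of P C \<longleftrightarrow> independent C \<and>
    {\<Sum>c\<in>C. of_int (k c) *\<^sub>R c | k :: real ^ 'n \<Rightarrow> int. True} =
    {x - y | x y. x \<in> affine hull P \<inter> int_points \<and> y \<in> affine hull P \<inter> int_points}"

definition parallelepiped :: "'a::real_vector set \<Rightarrow> 'a set" where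
  "parallelepiped C = {\<Sum>c\<in>C. f c *\<^sub>R c | f. \<forall>c\<in>C. 0 \<le> f c \<and> f c \<le> 1}"

text \<open>Only meaningful for lattice polytopes \<open>P\<close>. All fundamental parallelepipeds of the lattice
  have the same volume, so the choice of the basis \<open>C\<close> does not matter.\<close>

definition relvol :: "(real ^ 'n) set \<Rightarrow> real" where
  "relvol P = affine_volume P / affine_volume (parallelepiped (SOME C. lattice_basis_of P C))"

end

theory Submission
  imports Defs
begin

text \<open>
  The count agrees with a polynomial because all dilates of \<open>P\<close> fall apart, in the same way, into
  relatively open lattice simplices. It grows like the volume because the translates of a fundamental
  cell tile the direction space of \<open>P\<close>.

  Polynomiality. Let \<open>v\<^sub>0, \<dots>\<close> be the vertices of \<open>P\<close>. A point of \<open>t P\<close> is a combination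
  \<open>\<Sum> w\<^sub>i v\<^sub>i\<close> with nonnegative weights of total \<open>t\<close>, usually in many ways; exactly one of these weight
  vectors is lexicographically largest (\<open>ex1_lexmax_representation\<close>). Whether a weight vector is
  the largest one for its point depends on its support \<open>T\<close> alone, because it can be improved exactly
  when some affine relation among the vertices is lexicographically positive and nonnegative
  outside \<open>T\<close>. Hence \<open>t P\<close> is the disjoint union of the open simplices with vertices
  \<open>t v\<^sub>i\<close>, \<open>i \<in> T\<close>, where \<open>T\<close> runs over a finite family that does not depend on \<open>t\<close>; each such \<open>T\<close> is
  affinely independent. For a single open simplex on \<open>m\<close> vertices, every weight is split into a
  natural number and a part in the interval \<open>(0, 1]\<close>. As the vertices are integral, only the parts
  in \<open>(0, 1]\<close> decide whether the point translated by \<open>c\<close> is integral, so they range over a finite set.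
  If they add up to \<open>j\<close>, then \<open>1 \<le> j \<le> m\<close> and the natural parts form one of the
  \<open>(t - j + m - 1) choose (m - 1)\<close> compositions of \<open>t - j\<close>. This binomial polynomial vanishes for
  \<open>1 \<le> t < j\<close>, as the number of compositions does, and so the formula holds for all positive \<open>t\<close>
  (\<open>lattice_count_poly\<close>).

  Degree and leading coefficient. Let \<open>V\<close> be the direction space of \<open>P\<close>. Since \<open>P\<close> has an integral
  vertex, \<open>c + t P\<close> can contain an integer point only if \<open>c + V\<close> does; otherwise the polynomial is
  zero. If \<open>c + V\<close> contains an integer point, an integral translation turns the count into the number
  \<open>N\<close> of points of the lattice \<open>V \<inter> \<int>\<^sup>d\<close> in a set \<open>y + t K\<close>, where \<open>y \<in> V\<close> depends on \<open>t\<close> and the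
  translate \<open>K\<close> of \<open>P\<close> contains a neighbourhood of \<open>0\<close> in \<open>V\<close>. Attach to every lattice point a
  translate of the half-open cell \<open>D\<close> of a lattice basis. For a suitable constant \<open>r\<close>, the cells of
  the \<open>N\<close> points cover \<open>y + (t - r) K\<close> and lie inside \<open>y + (t + r) K\<close>. Comparing volumes gives
  \<open>(t - r)\<^sup>m vol K \<le> N vol D \<le> (t + r)\<^sup>m vol K\<close> with \<open>m = dim P\<close> (\<open>lattice_points_bounds\<close>). Therefore
  \<open>N / t\<^sup>m\<close> tends to the positive number \<open>relvol P\<close> (\<open>lattice_count_tendsto_relvol\<close>), which
  determines the degree and the leading coefficient of the polynomial (\<open>rat_poly_growth\<close>).
\<close>

section \<open>Lexicographically largest weights\<close>

text \<open>Weights and relations on \<open>n\<close> points are functions on \<open>nat\<close> that vanish from \<open>n\<close> on: the order of the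
  indices is what makes the lexicographic comparison of two weight vectors possible, and a weight vector
  \<open>w'\<close> beats \<open>w\<close> if the difference \<open>w' - w\<close> is positive in its first nonzero place.\<close>

definition lexpos :: "(nat \<Rightarrow> real) \<Rightarrow> bool" where
  "lexpos l \<longleftrightarrow> (\<exists>i. l i > 0 \<and> (\<forall>j<i. l j = 0))"

definition affine_relation :: "nat \<Rightarrow> (nat \<Rightarrow> 'a::real_vector) \<Rightarrow> (nat \<Rightarrow> real) \<Rightarrow> bool" where
  "affine_relation n v l \<longleftrightarrow> (\<forall>i\<ge>n. l i = 0) \<and> (\<Sum>i<n. l i) = 0 \<and> (\<Sum>i<n. l i *\<^sub>R v i) = 0"

definition represents :: "nat \<Rightarrow> (nat \<Rightarrow> 'a::real_vector) \<Rightarrow> real \<Rightarrow> 'a \<Rightarrow> (nat \<Rightarrow> real) \<Rightarrow> bool" where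
  "represents n v t y w \<longleftrightarrow> (\<forall>i. 0 \<le> w i) \<and> (\<forall>i\<ge>n. w i = 0) \<and> (\<Sum>i<n. w i) = t \<and>
     (\<Sum>i<n. w i *\<^sub>R v i) = y"

definition supp :: "(nat \<Rightarrow> real) \<Rightarrow> nat set" where
  "supp w = {i. w i \<noteq> 0}"

text \<open>Independence of an indexed family: two indices in \<open>T\<close> with the same point make it fail.\<close>

definition affine_indep :: "nat \<Rightarrow> (nat \<Rightarrow> 'a::real_vector) \<Rightarrow> nat set \<Rightarrow> bool" where
  "affine_indep n v T \<longleftrightarrow> (\<forall>l. affine_relation n v l \<and> supp l \<subseteq> T \<longrightarrow> supp l = {})"

text \<open>The relations excluded here are the directions in which a weight vector with support \<open>T\<close> can be
  moved a little so that it stays nonnegative, represents the same point, and becomes lexicographically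
  larger. Weights with support \<open>T\<close> are thus lexicographically largest or not according to \<open>T\<close>,
  whatever point and dilation factor they belong to.\<close>

definition lexmax_support :: "nat \<Rightarrow> (nat \<Rightarrow> 'a::real_vector) \<Rightarrow> nat set \<Rightarrow> bool" where
  "lexmax_support n v T \<longleftrightarrow> \<not> (\<exists>l. affine_relation n v l \<and> lexpos l \<and> (\<forall>i. i \<notin> T \<longrightarrow> 0 \<le> l i))"

lemma lexpos_add:
  assumes "lexpos a" "lexpos b"
  shows "lexpos (\<lambda>i. a i + b i)"
proof -
  obtain i k where i: "a i > 0" "\<And>j. j < i \<Longrightarrow> a j = 0" and k: "b k > 0" "\<And>j. j < k \<Longrightarrow> b j = 0"
    using assms unfolding lexpos_def by blast
  have "a (min i k) + b (min i k) > 0"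
    using i k by (cases i k rule: linorder_cases) (auto simp: min_def)
  moreover have "\<forall>j < min i k. a j + b j = 0"
    using i k by auto
  ultimately show ?thesis
    unfolding lexpos_def by blast
qed

lemma lexpos_cmult: "lexpos a \<Longrightarrow> 0 < s \<Longrightarrow> lexpos (\<lambda>i. s * a i)"
  unfolding lexpos_def by (metis mult_pos_pos mult_zero_right)

lemma lexpos_total:
  assumes "supp l \<noteq> {}"
  shows "lexpos l \<or> lexpos (\<lambda>i. - l i)"
proof -
  define i where "i = (LEAST i. l i \<noteq> 0)"
  have "\<exists>i. l i \<noteq> 0"
    using assms by (auto simp: supp_def)
  then have "l i \<noteq> 0" "\<And>j. j < i \<Longrightarrow> l j = 0"
    unfolding i_def by (metis (mono_tags, lifting) LeastI_ex, metis (mono_tags, lifting) not_less_Least)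
  then show ?thesis
    unfolding lexpos_def by (metis linorder_neqE_linordered_idom neg_0_less_iff_less neg_equal_0_iff_equal)
qed

lemma not_lexpos_zero: "\<not> lexpos (\<lambda>i. 0)"
  by (simp add: lexpos_def)

lemma affine_relation_uminus: "affine_relation n v l \<Longrightarrow> affine_relation n v (\<lambda>i. - l i)"
  by (simp add: affine_relation_def sum_negf)

lemma affine_relation_diff:
  "represents n v t y w \<Longrightarrow> represents n v t y w' \<Longrightarrow> affine_relation n v (\<lambda>i. w i - w' i)"
  by (simp add: affine_relation_def represents_def sum_subtractf scaleR_diff_left)

lemma represents_add_relation:
  assumes "represents n v t y w" "affine_relation n v l" "\<And>i. 0 \<le> w i + s * l i"
  shows "represents n v t y (\<lambda>i. w i + s * l i)"
  using assms
  by (simp add: affine_relation_def represents_def sum.distrib scaleR_add_left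
      flip: sum_distrib_left scaleR_scaleR scaleR_right.sum)

text \<open>A nontrivial relation supported on \<open>T\<close> vanishes outside \<open>T\<close>, and so does its negative; one of the two
  is lexicographically positive.\<close>

lemma affine_indep_if_lexmax_support:
  assumes "lexmax_support n v T"
  shows "affine_indep n v T"
  unfolding affine_indep_def
proof (intro allI impI, elim conjE)
  fix l assume l: "affine_relation n v l" "supp l \<subseteq> T"
  then have "\<And>i. i \<notin> T \<Longrightarrow> l i = 0"
    by (auto simp: supp_def)
  then show "supp l = {}"
    using assms l(1) lexpos_total[of l] affine_relation_uminus[OF l(1)]
    unfolding lexmax_support_def by (metis order_refl neg_equal_0_iff_equal)
qed

text \<open>Moving along an improving relation eventually hits the boundary of the weight simplex, because the
  coefficients of a relation add up to zero and so some of them are negative. The weight that vanishes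
  there was positive before: outside the support the relation only increases weights.\<close>

lemma push_representation:
  assumes w: "represents n v t y w" and l: "affine_relation n v l" "lexpos l"
    and nonneg: "\<And>i. i \<notin> supp w \<Longrightarrow> 0 \<le> l i"
  obtains w' i where "represents n v t y w'" "lexpos (\<lambda>i. w' i - w i)" "i \<in> supp w" "w' i = 0"
    "supp w' \<subseteq> supp w \<union> supp l"
proof -
  define N where "N = {i. l i < 0}"
  have N_less: "N \<subseteq> {..<n}"
    using l(1) by (force simp: N_def affine_relation_def not_le[symmetric])
  then have fin: "finite N"
    using finite_subset by blast
  have "N \<noteq> {}"
  proof
    assume "N = {}"
    then have ge: "\<And>i. 0 \<le> l i"
      by (auto simp: N_def not_less)
    have "(\<Sum>i<n. l i) = 0"
      using l(1) by (simp add: affine_relation_def)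
    then have "\<forall>i<n. l i = 0"
      using ge by (subst (asm) sum_nonneg_eq_0_iff) auto
    then have "l = (\<lambda>i. 0)"
      using l(1) by (auto simp: affine_relation_def not_less[symmetric])
    then show False
      using l(2) not_lexpos_zero by simp
  qed
  \<comment> \<open>The largest step that keeps all weights nonnegative.\<close>
  define s where "s = Min ((\<lambda>i. w i / - l i) ` N)"
  have "s \<in> (\<lambda>i. w i / - l i) ` N"
    unfolding s_def using fin \<open>N \<noteq> {}\<close> by (intro Min_in) auto
  then obtain k where k: "k \<in> N" "s = w k / - l k"
    by blast
  have s_le: "s \<le> w i / - l i" if "i \<in> N" for i
    unfolding s_def using fin that by (intro Min_le) auto
  have w_ge: "\<And>i. 0 \<le> w i"
    using w by (simp add: represents_def)
  have k_supp: "k \<in> supp w"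
    using nonneg[of k] k(1) by (force simp: N_def)
  have s_pos: "0 < s"
    using k k_supp w_ge[of k] by (auto simp: N_def supp_def less_le intro!: divide_nonneg_neg)
  have nn: "0 \<le> w i + s * l i" for i
  proof (cases "i \<in> N")
    case True
    then show ?thesis
      using s_le[OF True] by (simp add: N_def field_simps)
  next
    case False
    then show ?thesis
      using s_pos w_ge[of i] by (simp add: N_def)
  qed
  show thesis
  proof
    show "represents n v t y (\<lambda>i. w i + s * l i)"
      by (rule represents_add_relation[OF w l(1) nn])
    show "lexpos (\<lambda>i. w i + s * l i - w i)"
      using lexpos_cmult[OF l(2) s_pos] by simp
    show "w k + s * l k = 0"
      using k by (simp add: N_def)
  qed (use k_supp in \<open>auto simp: supp_def\<close>)
qed

lemma supp_subset: "represents n v t y w \<Longrightarrow> supp w \<subseteq> {..<n}"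
  unfolding represents_def supp_def by (auto simp: not_le[symmetric])

lemma finite_supp: "represents n v t y w \<Longrightarrow> finite (supp w)"
  using supp_subset finite_subset finite_lessThan by metis

text \<open>The usual reduction to affinely independent points, with the sign of the relation chosen such that
  each reduction step increases the weights lexicographically.\<close>

lemma lex_caratheodory:
  assumes "represents n v t y w"
  shows "\<exists>w'. represents n v t y w' \<and> affine_indep n v (supp w') \<and>
           (w' = w \<or> lexpos (\<lambda>i. w' i - w i))"
  using assms
proof (induction "card (supp w)" arbitrary: w rule: less_induct)
  case less
  show ?case
  proof (cases "affine_indep n v (supp w)")
    case True
    then show ?thesis using less.prems by blast
  next
    case False
    then obtain l where l: "affine_relation n v l" "supp l \<subseteq> supp w" "supp l \<noteq> {}"
      unfolding affine_indep_def by blast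
    have "\<exists>l. affine_relation n v l \<and> supp l \<subseteq> supp w \<and> lexpos l"
    proof (cases "lexpos l")
      case False
      then have "lexpos (\<lambda>i. - l i)"
        using lexpos_total l(3) by blast
      then show ?thesis
        using l(2) affine_relation_uminus[OF l(1)] by (force simp: supp_def)
    qed (use l in blast)
    then obtain l where l: "affine_relation n v l" "supp l \<subseteq> supp w" "lexpos l"
      by blast
    then have "\<And>i. i \<notin> supp w \<Longrightarrow> l i = 0"
      by (auto simp: supp_def)
    then have "\<And>i. i \<notin> supp w \<Longrightarrow> 0 \<le> l i"
      by simp
    then obtain w' i where w': "represents n v t y w'" "lexpos (\<lambda>i. w' i - w i)"
      "i \<in> supp w" "w' i = 0" "supp w' \<subseteq> supp w \<union> supp l"
      using push_representation[OF less.prems l(1,3)] by blast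
    have "i \<notin> supp w'"
      using w'(4) by (simp add: supp_def)
    then have "supp w' \<subset> supp w"
      using w'(3,5) l(2) by blast
    then have "card (supp w') < card (supp w)"
      using finite_supp[OF less.prems] psubset_card_mono by blast
    from less.hyps[OF this w'(1)] obtain u where
      u: "represents n v t y u" "affine_indep n v (supp u)" "u = w' \<or> lexpos (\<lambda>i. u i - w' i)"
      by blast
    then have "lexpos (\<lambda>i. u i - w i)"
      using w'(2) lexpos_add[of "\<lambda>i. u i - w' i" "\<lambda>i. w' i - w i"] by auto
    then show ?thesis
      using u by blast
  qed
qed

text \<open>Existence: only finitely many representations of a point have affinely independent support, and
  the reduction above leads from any improvement back to one of these; so the largest of them cannot be
  improved. Uniqueness: the difference of two representations is a relation, and with a suitable sign it
  improves one of them.\<close>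

lemma ex1_lexmax_representation:
  assumes "represents n v t y w0"
  shows "\<exists>!w. represents n v t y w \<and> lexmax_support n v (supp w)"
proof (rule ex_ex1I)
  define R where "R = {w. represents n v t y w \<and> affine_indep n v (supp w)}"
  have "inj_on supp R"
  proof
    fix w w' assume *: "w \<in> R" "w' \<in> R" "supp w = supp w'"
    then have "affine_relation n v (\<lambda>i. w i - w' i)"
      using affine_relation_diff unfolding R_def by blast
    moreover have "supp (\<lambda>i. w i - w' i) \<subseteq> supp w \<union> supp w'"
      by (auto simp: supp_def)
    then have "supp (\<lambda>i. w i - w' i) \<subseteq> supp w"
      using *(3) by blast
    ultimately have "supp (\<lambda>i. w i - w' i) = {}"
      using *(1) unfolding R_def affine_indep_def by blast
    then show "w = w'"
      by (auto simp: supp_def)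
  qed
  moreover have "supp ` R \<subseteq> Pow {..<n}"
    unfolding R_def using supp_subset by blast
  then have "finite (supp ` R)"
    using finite_subset by blast
  ultimately have "finite R"
    using finite_imageD by blast
  moreover have "R \<noteq> {}"
    using lex_caratheodory[OF assms] unfolding R_def by blast
  moreover have "asymp_on R (\<lambda>w w'. lexpos (\<lambda>i. w' i - w i))"
  proof (rule asymp_onI, rule notI)
    fix w w' assume "lexpos (\<lambda>i. w' i - w i)" "lexpos (\<lambda>i. w i - w' i)"
    from lexpos_add[OF this] show False
      using not_lexpos_zero by simp
  qed
  moreover have "transp_on R (\<lambda>w w'. lexpos (\<lambda>i. w' i - w i))"
  proof (rule transp_onI)
    fix a b c assume "lexpos (\<lambda>i. b i - a i)" "lexpos (\<lambda>i. c i - b i)"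
    from lexpos_add[OF this] show "lexpos (\<lambda>i. c i - a i)"
      by simp
  qed
  ultimately obtain w where "w \<in> R" and max: "\<And>w'. w' \<in> R \<Longrightarrow> w' \<noteq> w \<Longrightarrow> \<not> lexpos (\<lambda>i. w' i - w i)"
    using Finite_Set.bex_max_element[of R "\<lambda>w w'. lexpos (\<lambda>i. w' i - w i)"] by blast
  then have w: "represents n v t y w"
    by (simp add: R_def)
  have "lexmax_support n v (supp w)"
    unfolding lexmax_support_def
  proof
    assume "\<exists>l. affine_relation n v l \<and> lexpos l \<and> (\<forall>i. i \<notin> supp w \<longrightarrow> 0 \<le> l i)"
    then obtain w' where w': "represents n v t y w'" "lexpos (\<lambda>i. w' i - w i)"
      using push_representation[OF w] by metis
    obtain u where u: "represents n v t y u" "affine_indep n v (supp u)"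
      "u = w' \<or> lexpos (\<lambda>i. u i - w' i)"
      using lex_caratheodory[OF w'(1)] by blast
    then have "lexpos (\<lambda>i. u i - w i)"
      using w'(2) lexpos_add[of "\<lambda>i. u i - w' i" "\<lambda>i. w' i - w i"] by auto
    moreover from this have "u \<noteq> w"
      using not_lexpos_zero by auto
    ultimately show False
      using max[of u] u by (auto simp: R_def)
  qed
  then show "\<exists>w. represents n v t y w \<and> lexmax_support n v (supp w)"
    using w by blast
next
  fix w w'
  assume w: "represents n v t y w \<and> lexmax_support n v (supp w)"
    and w': "represents n v t y w' \<and> lexmax_support n v (supp w')"
  show "w = w'"
  proof (rule ccontr)
    have not_better: "\<not> lexpos (\<lambda>i. b i - a i)"
      if "represents n v t y a \<and> lexmax_support n v (supp a)" "represents n v t y b" for a b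
    proof -
      have "affine_relation n v (\<lambda>i. b i - a i)"
        using affine_relation_diff that by blast
      moreover have "\<forall>i. i \<notin> supp a \<longrightarrow> 0 \<le> b i - a i"
        using that(2) by (simp add: supp_def represents_def)
      ultimately show ?thesis
        using that(1) unfolding lexmax_support_def by blast
    qed
    assume "w \<noteq> w'"
    then have "supp (\<lambda>i. w i - w' i) \<noteq> {}"
      by (auto simp: supp_def)
    from lexpos_total[OF this] show False
      using not_better[of w w'] not_better[of w' w] w w' by simp
  qed
qed

section \<open>Integer points\<close>

lemma finite_int_points_bounded:
  fixes S :: "(real ^ 'n) set"
  assumes "bounded S"
  shows "finite (S \<inter> int_points)"
proof -
  obtain r where r: "\<And>x. x \<in> S \<Longrightarrow> norm x \<le> r"
    using assms unfolding bounded_iff by blast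
  have "($) ` (S \<inter> int_points) \<subseteq> (UNIV \<rightarrow>\<^sub>E {a \<in> \<int>. \<bar>a\<bar> \<le> r})"
    using r component_le_norm_cart order_trans by (fastforce simp: int_points_def)
  moreover have "finite (UNIV \<rightarrow>\<^sub>E {a \<in> \<int>. \<bar>a\<bar> \<le> r} :: ('n \<Rightarrow> real) set)"
    by (intro finite_PiE finite_abs_int_segment) auto
  ultimately have "finite (($) ` (S \<inter> int_points))"
    using finite_subset by blast
  then show ?thesis
    by (rule finite_imageD) (auto simp: inj_on_def vec_nth_inject)
qed

lemma int_points_add: "x \<in> int_points \<Longrightarrow> y \<in> int_points \<Longrightarrow> x + y \<in> int_points"
  by (simp add: int_points_def)

lemma int_points_diff: "x \<in> int_points \<Longrightarrow> y \<in> int_points \<Longrightarrow> x - y \<in> int_points"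
  by (simp add: int_points_def)

lemma int_points_scaleR: "a \<in> \<int> \<Longrightarrow> x \<in> int_points \<Longrightarrow> a *\<^sub>R x \<in> int_points"
  by (simp add: int_points_def)

lemma int_points_0: "0 \<in> int_points"
  by (simp add: int_points_def)

lemma int_points_sum: "(\<And>i. i \<in> I \<Longrightarrow> f i \<in> int_points) \<Longrightarrow> (\<Sum>i\<in>I. f i) \<in> int_points"
  by (induction I rule: infinite_finite_induct) (auto simp: int_points_0 int_points_add)

section \<open>Compositions\<close>

lemma bij_betw_compositions_lists:
  fixes ts :: "'a list"
  assumes "distinct ts"
  shows "bij_betw (\<lambda>k. map k ts) {k. (\<forall>i. i \<notin> set ts \<longrightarrow> k i = 0) \<and> sum k (set ts) = s}
    {l::nat list. length l = length ts \<and> sum_list l = s}"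
  unfolding bij_betw_def
proof (intro conjI equalityI subsetI)
  show "inj_on (\<lambda>k. map k ts) {k. (\<forall>i. i \<notin> set ts \<longrightarrow> k i = 0) \<and> sum k (set ts) = s}"
  proof (rule inj_onI, rule ext)
    fix k k' :: "'a \<Rightarrow> nat" and i
    assume "k \<in> {k. (\<forall>i. i \<notin> set ts \<longrightarrow> k i = 0) \<and> sum k (set ts) = s}"
      "k' \<in> {k. (\<forall>i. i \<notin> set ts \<longrightarrow> k i = 0) \<and> sum k (set ts) = s}" "map k ts = map k' ts"
    then show "k i = k' i"
      by (cases "i \<in> set ts") auto
  qed
next
  fix l assume "l \<in> (\<lambda>k. map k ts) ` {k. (\<forall>i. i \<notin> set ts \<longrightarrow> k i = 0) \<and> sum k (set ts) = s}"
  then show "l \<in> {l::nat list. length l = length ts \<and> sum_list l = s}"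
    using assms by (auto simp: sum_list_distinct_conv_sum_set)
next
  fix l assume "l \<in> {l::nat list. length l = length ts \<and> sum_list l = s}"
  then have l: "length l = length ts" "sum_list l = s"
    by auto
  define k where "k i = (case map_of (zip ts l) i of None \<Rightarrow> 0 | Some a \<Rightarrow> a)" for i
  have map_k: "map k ts = l"
    using assms l(1) by (intro nth_equalityI) (auto simp: k_def map_of_zip_nth)
  moreover have "k i = 0" if "i \<notin> set ts" for i
  proof -
    have "map_of (zip ts l) i = None"
      using that l(1) by (simp add: map_of_zip_is_None)
    then show ?thesis by (simp add: k_def)
  qed
  moreover have "sum k (set ts) = s"
    using sum_list_distinct_conv_sum_set[OF assms, of k] map_k l(2) by simp
  ultimately show "l \<in> (\<lambda>k. map k ts) ` {k. (\<forall>i. i \<notin> set ts \<longrightarrow> k i = 0) \<and> sum k (set ts) = s}"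
    by (intro image_eqI[of _ _ k]) auto
qed

text \<open>Compositions of \<open>s\<close> with parts indexed by \<open>T\<close>, where parts may be zero.\<close>

lemma card_compositions:
  assumes "finite T" "T \<noteq> {}"
  shows "card {k. (\<forall>i. i \<notin> T \<longrightarrow> k i = (0::nat)) \<and> sum k T = s} = (s + card T - 1) choose (card T - 1)"
proof -
  obtain ts where ts: "set ts = T" "distinct ts"
    using finite_distinct_list assms(1) by blast
  have m: "card T > 0"
    using assms by (simp add: card_gt_0_iff)
  have "card {k. (\<forall>i. i \<notin> T \<longrightarrow> k i = (0::nat)) \<and> sum k T = s} = (s + length ts - 1) choose s"
    using bij_betw_same_card[OF bij_betw_compositions_lists[OF ts(2), of s]] ts(1) card_length_sum_list
    by simp
  moreover have "length ts = card T"
    using distinct_card ts by metis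
  moreover have "(s + card T - 1) choose s = (s + card T - 1) choose (card T - 1)"
    using m binomial_symmetric[of s "s + card T - 1"] by simp
  ultimately show ?thesis by simp
qed

lemma finite_compositions:
  assumes "finite T"
  shows "finite {k. (\<forall>i. i \<notin> T \<longrightarrow> k i = (0::nat)) \<and> sum k T = s}"
proof -
  obtain ts where ts: "set ts = T" "distinct ts"
    using finite_distinct_list assms(1) by blast
  have "finite {l::nat list. length l = length ts \<and> sum_list l = s}"
    by (rule finite_subset[OF _ finite_lists_length_eq[of "{..s}" "length ts"]])
      (auto intro: member_le_sum_list)
  then show ?thesis
    using bij_betw_finite[OF bij_betw_compositions_lists[OF ts(2), of s]] ts(1) by simp
qed

text \<open>The hypothesis excludes truncated subtraction. It still allows \<open>j > t\<close>, where the binomial coefficient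
  may be zero without its upper argument being negative.\<close>

lemma binomial_poly:
  "\<exists>q :: rat poly. \<forall>t. j \<le> t + a \<longrightarrow> of_nat ((t + a - j) choose b) = poly q (of_nat t)"
proof (intro exI allI impI)
  fix t :: nat assume "j \<le> t + a"
  then have "rat_of_nat ((t + a - j) choose b) = (of_nat t + of_nat a - of_nat j) gchoose b"
    by (simp add: binomial_gbinomial of_nat_diff)
  then show "rat_of_nat ((t + a - j) choose b) =
      poly (smult (1 / fact b) (\<Prod>i = 0..<b. [:of_nat a - of_nat j - of_nat i, 1:])) (of_nat t)"
    by (simp add: gbinomial_prod_rev poly_prod algebra_simps)
qed

section \<open>Lattice points in dilated polytopes: polynomiality\<close>

text \<open>Inside the open simplex with vertices \<open>t v\<^sub>i\<close>, \<open>i \<in> T\<close>, these weights stand for the points whose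
  translate by \<open>c\<close> is integral.\<close>

definition lattice_weights ::
  "nat \<Rightarrow> (nat \<Rightarrow> real ^ 'n) \<Rightarrow> real ^ 'n \<Rightarrow> nat set \<Rightarrow> real \<Rightarrow> (nat \<Rightarrow> real) set" where
  "lattice_weights n v c T t = {w. (\<forall>i. 0 \<le> w i) \<and> supp w = T \<and> (\<Sum>i<n. w i) = t \<and>
     c + (\<Sum>i<n. w i *\<^sub>R v i) \<in> int_points}"

text \<open>The parts of the weights that lie in \<open>(0, 1]\<close>. Their total is a positive integer at most \<open>card T\<close>,
  as it differs from the dilation factor by a sum of natural numbers and each part is at most 1.\<close>

definition unit_lattice_weights ::
  "nat \<Rightarrow> (nat \<Rightarrow> real ^ 'n) \<Rightarrow> real ^ 'n \<Rightarrow> nat set \<Rightarrow> (nat \<Rightarrow> real) set" where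
  "unit_lattice_weights n v c T =
     (\<Union>j\<in>{1..card T}. {f \<in> lattice_weights n v c T (real j). \<forall>i. f i \<le> 1})"

lemma sum_supp: "T \<subseteq> {..<n::nat} \<Longrightarrow> (\<And>i. i \<notin> T \<Longrightarrow> k i = 0) \<Longrightarrow> (\<Sum>i<n. k i) = sum k T"
  by (intro sum.mono_neutral_right) auto

lemma affine_indep_weights_unique:
  assumes indep: "affine_indep n v T" and T: "T \<subseteq> {..<n}"
    and f: "supp f = T" and g: "supp g = T"
    and eq: "(\<Sum>i<n. f i) = (\<Sum>i<n. g i)" "(\<Sum>i<n. f i *\<^sub>R v i) = (\<Sum>i<n. g i *\<^sub>R v i)"
  shows "f = g"
proof -
  have zero: "f i = 0" "g i = 0" if "i \<notin> T" for i
    using that f g unfolding supp_def by blast+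
  then have "f i - g i = 0" if "n \<le> i" for i
    using T that by (metis diff_self lessThan_iff not_le subsetD)
  then have "affine_relation n v (\<lambda>i. f i - g i)"
    using eq by (simp add: affine_relation_def sum_subtractf scaleR_diff_left)
  moreover have "supp (\<lambda>i. f i - g i) \<subseteq> T"
    using zero by (force simp: supp_def)
  ultimately have "supp (\<lambda>i. f i - g i) = {}"
    using indep unfolding affine_indep_def by blast
  then show ?thesis
    by (auto simp: supp_def)
qed

text \<open>Independence makes the weights of a fixed total recoverable from the integer point that they
  represent, and this point stays in a bounded region.\<close>

lemma finite_unit_lattice_weights:
  assumes indep: "affine_indep n v T" and T: "T \<subseteq> {..<n}"
  shows "finite (unit_lattice_weights n v c T)"
  unfolding unit_lattice_weights_def
proof (intro finite_UN_I)
  fix j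
  let ?F = "{f \<in> lattice_weights n v c T (real j). \<forall>i. f i \<le> 1}"
  let ?h = "\<lambda>f. c + (\<Sum>i<n. f i *\<^sub>R v i)"
  have "inj_on ?h ?F"
    by (rule inj_onI, rule affine_indep_weights_unique[OF indep T]) (auto simp: lattice_weights_def)
  moreover have "?h ` ?F \<subseteq> cball c (\<Sum>i<n. norm (v i)) \<inter> int_points"
  proof (intro image_subsetI IntI)
    fix f assume f: "f \<in> ?F"
    then show "?h f \<in> int_points"
      by (simp add: lattice_weights_def)
    have "norm (\<Sum>i<n. f i *\<^sub>R v i) \<le> (\<Sum>i<n. norm (v i))"
      using f by (intro sum_norm_le) (auto simp: lattice_weights_def intro!: mult_left_le_one_le)
    then show "?h f \<in> cball c (\<Sum>i<n. norm (v i))"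
      by (simp add: dist_norm)
  qed
  then have "finite (?h ` ?F)"
    using finite_int_points_bounded[OF bounded_cball] finite_subset by blast
  ultimately show "finite ?F"
    using finite_imageD by blast
qed simp

text \<open>The natural part of a positive weight \<open>w\<close> is \<open>\<lceil>w\<rceil> - 1\<close>, so that the rest lies in \<open>(0, 1]\<close>. Subtracting
  natural multiples of the integral vertices does not affect integrality.\<close>

lemma bij_betw_lattice_weights:
  assumes T: "T \<subseteq> {..<n}" "T \<noteq> {}" and v: "\<And>i. i < n \<Longrightarrow> v i \<in> int_points"
  shows "bij_betw (\<lambda>(f, k) i. f i + real (k i))
    (SIGMA f:unit_lattice_weights n v c T.
      {k. (\<forall>i. i \<notin> T \<longrightarrow> k i = 0) \<and> real (sum k T) + (\<Sum>i<n. f i) = real t})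
    (lattice_weights n v c T (real t))"
    (is "bij_betw ?h ?S ?W")
  unfolding bij_betw_def
proof (intro conjI equalityI subsetI)
  have sum_k: "(\<Sum>i<n. f i + real (k i)) = (\<Sum>i<n. f i) + real (sum k T)"
    if "\<forall>i. i \<notin> T \<longrightarrow> k i = 0" for f k
    using sum_supp[OF T(1), of k] that by (simp add: sum.distrib flip: of_nat_sum)
  have int: "(\<Sum>i<n. real (k i) *\<^sub>R v i) \<in> int_points" for k
    using v by (intro int_points_sum int_points_scaleR) auto
  have split_sum: "(\<Sum>i<n. (f i + real (k i)) *\<^sub>R v i) =
      (\<Sum>i<n. f i *\<^sub>R v i) + (\<Sum>i<n. real (k i) *\<^sub>R v i)" for f k
    by (simp add: scaleR_add_left sum.distrib)
  have unit: "0 < f i" "f i \<le> 1" if "f \<in> unit_lattice_weights n v c T" "i \<in> T" for f i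
    using that by (auto simp: unit_lattice_weights_def lattice_weights_def supp_def less_le)
  have off: "f i = 0" if "f \<in> unit_lattice_weights n v c T" "i \<notin> T" for f i
    using that by (auto simp: unit_lattice_weights_def lattice_weights_def supp_def)
  show "inj_on ?h ?S"
  proof (rule inj_onI, clarify)
    fix f k g l
    assume f: "f \<in> unit_lattice_weights n v c T" and g: "g \<in> unit_lattice_weights n v c T"
      and k: "\<forall>i. i \<notin> T \<longrightarrow> k i = 0" and l: "\<forall>i. i \<notin> T \<longrightarrow> l i = 0"
      and eq: "(\<lambda>i. f i + real (k i)) = (\<lambda>i. g i + real (l i))"
    have "k i = l i" for i
    proof (cases "i \<in> T")
      case True
      have "f i + real (k i) = g i + real (l i)"
        using eq by meson
      then have "\<bar>real (k i) - real (l i)\<bar> < 1"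
        using unit[OF f True] unit[OF g True] by linarith
      then show ?thesis by linarith
    qed (use k l in simp)
    then have "k = l" by blast
    moreover from this have "f = g"
      using eq by (simp add: fun_eq_iff)
    ultimately show "f = g \<and> k = l" by blast
  qed
  fix w
  { assume "w \<in> ?h ` ?S"
    then obtain f k where f: "f \<in> unit_lattice_weights n v c T"
      and k: "\<forall>i. i \<notin> T \<longrightarrow> k i = 0" "real (sum k T) + (\<Sum>i<n. f i) = real t"
      and w: "w = (\<lambda>i. f i + real (k i))"
      by (elim imageE SigmaE) auto
    have "w i \<noteq> 0 \<longleftrightarrow> i \<in> T" for i
      using unit[OF f, of i] off[OF f, of i] k(1) by (cases "i \<in> T") (auto simp: w)
    then have "supp w = T"
      by (auto simp: supp_def)
    moreover have "0 \<le> w i" for i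
      using unit[OF f, of i] off[OF f, of i] by (cases "i \<in> T") (auto simp: w)
    moreover have "(\<Sum>i<n. w i) = real t"
      using sum_k[OF k(1)] k(2) by (simp add: w)
    moreover have "c + (\<Sum>i<n. f i *\<^sub>R v i) \<in> int_points"
      using f by (auto simp: unit_lattice_weights_def lattice_weights_def)
    then have "c + (\<Sum>i<n. w i *\<^sub>R v i) \<in> int_points"
      using int_points_add[OF _ int[of k]] by (simp add: w split_sum flip: add.assoc)
    ultimately show "w \<in> ?W"
      by (simp add: lattice_weights_def)
  }
  assume w: "w \<in> ?W"
  then have w_T: "0 < w i \<longleftrightarrow> i \<in> T" for i
    by (auto simp: lattice_weights_def supp_def less_le)
  have w_off: "w i = 0" if "i \<notin> T" for i
    using w that by (auto simp: lattice_weights_def supp_def)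
  define k where "k i = nat (\<lceil>w i\<rceil> - 1)" for i
  define f where "f i = w i - real (k i)" for i
  have k_off: "\<forall>i. i \<notin> T \<longrightarrow> k i = 0"
    using w_off by (simp add: k_def)
  have f_off: "f i = 0" if "i \<notin> T" for i
    using that w_off k_off by (simp add: f_def)
  have f_unit: "0 < f i \<and> f i \<le> 1" if "i \<in> T" for i
  proof -
    have "0 < w i"
      using that w_T by simp
    then have "real (k i) = of_int \<lceil>w i\<rceil> - 1"
      by (simp add: k_def)
    then show ?thesis
      unfolding f_def by linarith
  qed
  have supp_f: "supp f = T"
    using f_unit f_off unfolding supp_def by (metis (mono_tags, lifting) Collect_cong Collect_mem_eq less_irrefl)
  have w_eq: "w = (\<lambda>i. f i + real (k i))"
    by (simp add: f_def)
  have "(\<Sum>i<n. w i) = real t"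
    using w by (simp add: lattice_weights_def)
  then have sum_w: "real (sum k T) + (\<Sum>i<n. f i) = real t"
    using sum_k[OF k_off, of f] unfolding w_eq by linarith
  define j where "j = nat (int t - int (sum k T))"
  have sum_f: "(\<Sum>i<n. f i) = sum f T"
    using sum_supp[OF T(1) f_off] .
  have fT: "finite T"
    using T finite_subset by blast
  have f_nonneg: "0 \<le> f i" for i
    using f_unit[of i] f_off[of i] by (cases "i \<in> T") auto
  have "0 \<le> (\<Sum>i<n. f i)"
    by (simp add: sum_nonneg f_nonneg)
  then have j: "real j = (\<Sum>i<n. f i)"
    using sum_w unfolding j_def by linarith
  have "0 < sum f T"
    using T(2) f_unit fT by (intro sum_pos) auto
  moreover have "sum f T \<le> card T"
    using sum_mono[of T f "\<lambda>_. 1"] f_unit by simp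
  ultimately have "j \<in> {1..card T}"
    using j sum_f by auto
  moreover have "c + (\<Sum>i<n. w i *\<^sub>R v i) \<in> int_points"
    using w by (simp add: lattice_weights_def)
  then have "c + (\<Sum>i<n. f i *\<^sub>R v i) \<in> int_points"
    using int_points_diff[OF _ int[of k]] by (simp add: w_eq split_sum flip: add.assoc) (metis add_diff_cancel_right')
  moreover have "\<forall>i. f i \<le> 1"
    using f_unit f_off by (metis zero_le_one)
  ultimately have "f \<in> unit_lattice_weights n v c T"
    unfolding unit_lattice_weights_def lattice_weights_def
    using supp_f f_nonneg j by (intro UN_I[of j]) auto
  then show "w \<in> ?h ` ?S"
    using k_off sum_w by (intro image_eqI[of _ _ "(f, k)"]) (auto simp: w_eq)
qed

text \<open>For each of the finitely many choices of the parts in \<open>(0, 1]\<close>, the natural parts are the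
  compositions of \<open>t - j\<close>, with \<open>j\<close> the total of the chosen parts. The case \<open>0 < t < j\<close> has no compositions,
  and there the binomial coefficient is zero too, because \<open>j \<le> card T\<close> keeps its upper argument in the
  range from \<open>0\<close> to \<open>card T - 2\<close>.\<close>

lemma lattice_weights_poly:
  assumes indep: "affine_indep n v T" and T: "T \<subseteq> {..<n}"
    and v: "\<And>i. i < n \<Longrightarrow> v i \<in> int_points"
  shows "\<exists>p :: rat poly. \<forall>t::nat. t > 0 \<longrightarrow>
    of_nat (card (lattice_weights n v c T (real t))) = poly p (of_nat t)"
proof (cases "T = {}")
  case True
  have "lattice_weights n v c T (real t) = {}" if "t > 0" for t
    using that by (auto simp: True lattice_weights_def supp_def)
  then show ?thesis
    by (intro exI[of _ 0]) simp
next
  case False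
  let ?F = "unit_lattice_weights n v c T"
  let ?K = "\<lambda>t f. {k. (\<forall>i. i \<notin> T \<longrightarrow> k i = 0) \<and> real (sum k T) + (\<Sum>i<n. f i) = real t}"
  have fT: "finite T"
    using T finite_subset by blast
  have finF: "finite ?F"
    by (rule finite_unit_lattice_weights[OF indep T])
  have "\<exists>q :: rat poly. \<forall>t::nat. t > 0 \<longrightarrow>
    finite (?K t f) \<and> of_nat (card (?K t f)) = poly q (of_nat t)" if f: "f \<in> ?F" for f
  proof -
    obtain j where j: "1 \<le> j" "j \<le> card T" "(\<Sum>i<n. f i) = real j"
      using f by (auto simp: unit_lattice_weights_def lattice_weights_def)
    obtain q :: "rat poly" where
      q: "\<And>t. j \<le> t + (card T - 1) \<Longrightarrow> of_nat ((t + (card T - 1) - j) choose (card T - 1)) = poly q (of_nat t)"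
      using binomial_poly by blast
    have "finite (?K t f) \<and> card (?K t f) = (t + (card T - 1) - j) choose (card T - 1)" if "t > 0" for t
    proof (cases "j \<le> t")
      case True
      have "real s + real j = real t \<longleftrightarrow> s = t - j" for s
        unfolding of_nat_add[symmetric] of_nat_eq_iff using True by presburger
      then have "?K t f = {k. (\<forall>i. i \<notin> T \<longrightarrow> k i = 0) \<and> sum k T = t - j}"
        unfolding j(3) by (simp del: of_nat_sum)
      then show ?thesis
        using finite_compositions[OF fT, of "t - j"] card_compositions[OF fT False, of "t - j"] True j
        by simp
    next
      case False
      have "?K t f = {}"
        unfolding j(3) of_nat_add[symmetric] of_nat_eq_iff using False by auto
      moreover have "t + (card T - 1) - j < card T - 1"
        using False j that by linarith
      ultimately show ?thesis
        by (metis binomial_eq_0 card.empty finite.emptyI)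
    qed
    then have "finite (?K t f) \<and> of_nat (card (?K t f)) = poly q (of_nat t)" if "t > 0" for t
      using that q[of t] j by simp
    then show ?thesis by blast
  qed
  then have "\<forall>f\<in>?F. \<exists>q :: rat poly. \<forall>t::nat. t > 0 \<longrightarrow>
    finite (?K t f) \<and> of_nat (card (?K t f)) = poly q (of_nat t)"
    by blast
  from bchoice[OF this] obtain q :: "(nat \<Rightarrow> real) \<Rightarrow> rat poly" where
    q: "\<And>f t. f \<in> ?F \<Longrightarrow> t > 0 \<Longrightarrow> finite (?K t f) \<and> of_nat (card (?K t f)) = poly (q f) (of_nat t)"
    by blast
  show ?thesis
  proof (intro exI allI impI)
    fix t :: nat assume t: "t > 0"
    have "card (lattice_weights n v c T (real t)) = card (SIGMA f:?F. ?K t f)"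
      using bij_betw_same_card[OF bij_betw_lattice_weights[OF T False v]] by simp
    also have "\<dots> = (\<Sum>f\<in>?F. card (?K t f))"
      using finF q t by (intro card_SigmaI) auto
    finally have "rat_of_nat (card (lattice_weights n v c T (real t))) = (\<Sum>f\<in>?F. of_nat (card (?K t f)))"
      by simp
    also have "\<dots> = (\<Sum>f\<in>?F. poly (q f) (of_nat t))"
      using q t by (intro sum.cong) auto
    finally show "rat_of_nat (card (lattice_weights n v c T (real t))) = poly (\<Sum>f\<in>?F. q f) (of_nat t)"
      by (simp add: poly_sum)
  qed
qed

lemma dilated_hull_iff:
  fixes v :: "nat \<Rightarrow> 'a::real_vector"
  assumes v: "bij_betw v {..<n} S" and t: "0 < t"
  shows "(\<exists>x\<in>convex hull S. y = t *\<^sub>R x) \<longleftrightarrow> (\<exists>w. represents n v t y w)"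
proof
  have S: "finite S"
    using v bij_betw_finite by blast
  assume "\<exists>x\<in>convex hull S. y = t *\<^sub>R x"
  then obtain u where u: "\<And>x. x \<in> S \<Longrightarrow> 0 \<le> u x" "sum u S = 1" "y = t *\<^sub>R (\<Sum>x\<in>S. u x *\<^sub>R x)"
    unfolding convex_hull_finite[OF S] by blast
  define w where "w i = (if i < n then t * u (v i) else 0)" for i
  have "(\<Sum>i<n. w i) = t * (\<Sum>i<n. u (v i))"
    by (simp add: w_def sum_distrib_left)
  also have "(\<Sum>i<n. u (v i)) = 1"
    using u(2) sum.reindex_bij_betw[OF v, of u] by simp
  finally have "(\<Sum>i<n. w i) = t" by simp
  moreover have "(\<Sum>i<n. w i *\<^sub>R v i) = t *\<^sub>R (\<Sum>i<n. u (v i) *\<^sub>R v i)"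
    by (simp add: w_def scaleR_sum_right)
  then have "(\<Sum>i<n. w i *\<^sub>R v i) = y"
    using u(3) sum.reindex_bij_betw[OF v, of "\<lambda>x. u x *\<^sub>R x"] by simp
  moreover have "0 \<le> w i" for i
    using u(1) t bij_betwE[OF v] by (simp add: w_def)
  ultimately show "\<exists>w. represents n v t y w"
    unfolding represents_def by (intro exI[of _ w]) (auto simp: w_def)
next
  assume "\<exists>w. represents n v t y w"
  then obtain w where w: "represents n v t y w" by blast
  have "(\<Sum>i\<in>{..<n}. (w i / t) *\<^sub>R v i) \<in> convex hull S"
  proof (rule convex_sum)
    show "(\<Sum>i<n. w i / t) = 1"
      using w t by (simp add: represents_def flip: sum_divide_distrib)
    show "v i \<in> convex hull S" if "i \<in> {..<n}" for i
      using bij_betwE[OF v] that by (simp add: hull_inc)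
  qed (use w t in \<open>auto simp: represents_def\<close>)
  moreover have "y = t *\<^sub>R (\<Sum>i\<in>{..<n}. (w i / t) *\<^sub>R v i)"
    using w t by (simp add: represents_def scaleR_sum_right)
  ultimately show "\<exists>x\<in>convex hull S. y = t *\<^sub>R x"
    by blast
qed

lemma lattice_polytope_hull:
  assumes "lattice_polytope P"
  obtains S where "finite S" "S \<subseteq> int_points" "P = convex hull S" "S \<noteq> {}"
proof
  let ?S = "{v. v extreme_point_of P}"
  have P: "polytope P" "P \<noteq> {}" "?S \<subseteq> int_points"
    using assms by (auto simp: lattice_polytope_def)
  show "finite ?S"
    using P by (simp add: finite_polyhedron_extreme_points polytope_imp_polyhedron)
  show "P = convex hull ?S"
    using P by (simp add: Krein_Milman_Minkowski polytope_imp_compact polytope_imp_convex)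
  then show "?S \<noteq> {}"
    using P(2) by force
qed (use assms in \<open>auto simp: lattice_polytope_def\<close>)

text \<open>Every point of the dilate has exactly one lexicographically largest weight vector, so the count is the
  sum of the counts for the open simplices on the supports \<open>T\<close> of such vectors, and the family of these
  supports is the same for all \<open>t\<close>.\<close>

lemma lattice_count_poly:
  fixes P :: "(real ^ 'n) set"
  assumes "lattice_polytope P"
  shows "\<exists>p :: rat poly. \<forall>t::nat. t > 0 \<longrightarrow> of_nat (lattice_count P c t) = poly p (of_nat t)"
proof -
  obtain S where S: "finite S" "S \<subseteq> int_points" "P = convex hull S"
    using lattice_polytope_hull[OF assms] by blast
  obtain v where v: "bij_betw v {..<card S} S"
    using ex_bij_betw_nat_finite[OF S(1)] by (auto simp: atLeast0LessThan)
  define n where "n = card S"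
  note v = v[folded n_def]
  have v_int: "v i \<in> int_points" if "i < n" for i
    using bij_betwE[OF v] S(2) that by blast
  define \<T> where "\<T> = {T \<in> Pow {..<n}. lexmax_support n v T}"
  have indep: "affine_indep n v T" "T \<subseteq> {..<n}" if "T \<in> \<T>" for T
    using that affine_indep_if_lexmax_support by (auto simp: \<T>_def)
  have fin\<T>: "finite \<T>"
    by (simp add: \<T>_def)
  have "\<forall>T\<in>\<T>. \<exists>p :: rat poly. \<forall>t::nat. t > 0 \<longrightarrow>
      of_nat (card (lattice_weights n v c T (real t))) = poly p (of_nat t)"
    using indep v_int by (intro ballI lattice_weights_poly) auto
  from bchoice[OF this] obtain q :: "nat set \<Rightarrow> rat poly" where
    q: "\<And>T t. T \<in> \<T> \<Longrightarrow> t > 0 \<Longrightarrow>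
      of_nat (card (lattice_weights n v c T (real t))) = poly (q T) (of_nat t)"
    by blast
  let ?g = "\<lambda>w. c + (\<Sum>i<n. w i *\<^sub>R v i)"
  have rep: "represents n v t (\<Sum>i<n. w i *\<^sub>R v i) w"
    if "w \<in> lattice_weights n v c T t" "T \<subseteq> {..<n}" for w T t
  proof -
    have "w i = 0" if "n \<le> i" for i
    proof -
      have "i \<notin> supp w"
        using that \<open>w \<in> lattice_weights n v c T t\<close> \<open>T \<subseteq> {..<n}\<close> by (auto simp: lattice_weights_def)
      then show ?thesis by (simp add: supp_def)
    qed
    then show ?thesis
      using that by (auto simp: represents_def lattice_weights_def)
  qed
  have fin: "finite (lattice_weights n v c T (real t))" if "T \<in> \<T>" for T t
  proof -
    have "inj_on ?g (lattice_weights n v c T (real t))"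
      by (rule inj_onI, rule affine_indep_weights_unique[OF indep[OF that]]) (auto simp: lattice_weights_def)
    moreover have "?g ` lattice_weights n v c T (real t) \<subseteq>
        cball c (\<Sum>i<n. real t * norm (v i)) \<inter> int_points"
    proof (intro image_subsetI IntI)
      fix w assume w: "w \<in> lattice_weights n v c T (real t)"
      then show "?g w \<in> int_points"
        by (simp add: lattice_weights_def)
      have "w i \<le> real t" if "i < n" for i
        using w that member_le_sum[of i "{..<n}" w] by (auto simp: lattice_weights_def)
      then have "norm (\<Sum>i<n. w i *\<^sub>R v i) \<le> (\<Sum>i<n. real t * norm (v i))"
        using w by (intro sum_norm_le) (auto simp: lattice_weights_def intro!: mult_right_mono)
      then show "?g w \<in> cball c (\<Sum>i<n. real t * norm (v i))"
        by (simp add: dist_norm)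
    qed
    then have "finite (?g ` lattice_weights n v c T (real t))"
      using finite_int_points_bounded[OF bounded_cball] finite_subset by blast
    ultimately show ?thesis
      using finite_imageD by blast
  qed
  show ?thesis
  proof (intro exI allI impI)
    fix t :: nat assume t: "t > 0"
    let ?W = "\<Union>T\<in>\<T>. lattice_weights n v c T (real t)"
    let ?X = "(\<lambda>x. c + real t *\<^sub>R x) ` P \<inter> int_points"
    have "bij_betw ?g ?W ?X"
      unfolding bij_betw_def
    proof (intro conjI equalityI subsetI)
      show "inj_on ?g ?W"
      proof (rule inj_onI)
        fix w w' assume "w \<in> ?W" "w' \<in> ?W" and eq: "?g w = ?g w'"
        then obtain T T' where T: "T \<in> \<T>" "w \<in> lattice_weights n v c T (real t)"
          and T': "T' \<in> \<T>" "w' \<in> lattice_weights n v c T' (real t)"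
          by blast
        have "supp w = T" "supp w' = T'"
          using T(2) T'(2) by (simp_all add: lattice_weights_def)
        then show "w = w'"
          using ex1_lexmax_representation[OF rep[OF T(2) indep(2)[OF T(1)]]] T T'
            rep[OF T(2) indep(2)[OF T(1)]] rep[OF T'(2) indep(2)[OF T'(1)]] eq
          unfolding \<T>_def by (metis (mono_tags, lifting) add_left_cancel mem_Collect_eq)
      qed
    next
      fix z assume "z \<in> ?g ` ?W"
      then obtain T w where T: "T \<in> \<T>" "w \<in> lattice_weights n v c T (real t)" and z: "z = ?g w"
        by blast
      have "\<exists>x\<in>P. (\<Sum>i<n. w i *\<^sub>R v i) = real t *\<^sub>R x"
        using dilated_hull_iff[OF v, of "real t"] rep[OF T(2) indep(2)[OF T(1)]] t S(3) by auto
      moreover have "z \<in> int_points"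
        using T(2) z by (simp add: lattice_weights_def)
      ultimately show "z \<in> ?X"
        using z by auto
    next
      fix z assume z: "z \<in> ?X"
      then obtain x where x: "x \<in> P" "z = c + real t *\<^sub>R x" by blast
      then obtain w0 where "represents n v (real t) (real t *\<^sub>R x) w0"
        using dilated_hull_iff[OF v, of "real t" "real t *\<^sub>R x"] t S(3) by auto
      then obtain w where w: "represents n v (real t) (real t *\<^sub>R x) w" "lexmax_support n v (supp w)"
        using ex1_lexmax_representation by blast
      have "supp w \<in> \<T>"
        using w(2) supp_subset[OF w(1)] by (simp add: \<T>_def)
      moreover have "z = ?g w"
        using w(1) x(2) by (simp add: represents_def)
      moreover from this have "w \<in> lattice_weights n v c (supp w) (real t)"
        using w(1) z by (auto simp: lattice_weights_def represents_def)
      ultimately show "z \<in> ?g ` ?W"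
        by blast
    qed
    then have "lattice_count P c t = card ?W"
      unfolding lattice_count_def by (rule bij_betw_same_card[symmetric])
    also have "\<dots> = (\<Sum>T\<in>\<T>. card (lattice_weights n v c T (real t)))"
      using fin\<T> fin by (intro card_UN_disjoint) (auto simp: lattice_weights_def)
    finally have "rat_of_nat (lattice_count P c t) =
        (\<Sum>T\<in>\<T>. of_nat (card (lattice_weights n v c T (real t))))"
      by simp
    also have "\<dots> = (\<Sum>T\<in>\<T>. poly (q T) (of_nat t))"
      using q t by (intro sum.cong) auto
    finally show "rat_of_nat (lattice_count P c t) = poly (\<Sum>T\<in>\<T>. q T) (of_nat t)"
      by (simp add: poly_sum)
  qed
qed

section \<open>Lebesgue measure on a subspace\<close>

lemma emeasure_lborel_affine_vimage:
  fixes A :: "real set"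
  assumes "A \<in> sets borel" "0 < s"
  shows "emeasure lborel ((\<lambda>x. (x - a) / s) -` A) = ennreal s * emeasure lborel A"
proof -
  have m: "(\<lambda>x. - a / s + (1 / s) * x) \<in> borel_measurable borel"
    by measurable
  have eq: "(\<lambda>x. - a / s + (1 / s) * x) = (\<lambda>x. (x - a) / s)"
    by (auto simp: diff_divide_distrib)
  have "emeasure lborel A = emeasure (density (distr lborel borel (\<lambda>x. - a / s + (1 / s) * x)) (\<lambda>_. ennreal \<bar>1 / s\<bar>)) A"
    using lborel_real_affine[of "1 / s" "- a / s"] assms(2) by simp
  also have "\<dots> = ennreal (1 / s) * emeasure (distr lborel borel (\<lambda>x. - a / s + (1 / s) * x)) A"
    using assms by (subst emeasure_density) (auto simp: nn_integral_cmult)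
  also have "emeasure (distr lborel borel (\<lambda>x. - a / s + (1 / s) * x)) A = emeasure lborel ((\<lambda>x. (x - a) / s) -` A)"
    unfolding eq[symmetric] using assms(1) m by (subst emeasure_distr) auto
  finally have "emeasure lborel A = ennreal (1 / s) * emeasure lborel ((\<lambda>x. (x - a) / s) -` A)" .
  moreover have "ennreal s * ennreal (1 / s) = 1"
    using assms(2) by (simp flip: ennreal_mult)
  ultimately show ?thesis
    by (metis mult.assoc mult_1)
qed

text \<open>Both sides are measures in \<open>X\<close> that agree on boxes, where the claim follows from the
  one-dimensional one.\<close>

lemma emeasure_PiM_lborel_affine:
  fixes a :: "'i \<Rightarrow> real"
  assumes fin: "finite I" and s: "0 < s" and X: "X \<in> sets (\<Pi>\<^sub>M i\<in>I. lborel)"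
  shows "emeasure (\<Pi>\<^sub>M i\<in>I. lborel)
      ((\<lambda>f. \<lambda>i\<in>I. (f i - a i) / s) -` X \<inter> space (\<Pi>\<^sub>M i\<in>I. lborel)) =
    ennreal (s ^ card I) * emeasure (\<Pi>\<^sub>M i\<in>I. lborel) X"
proof -
  interpret product_sigma_finite "\<lambda>_::'i. lborel :: real measure"
    by standard
  let ?M = "\<Pi>\<^sub>M i\<in>I. lborel :: real measure"
  let ?g = "\<lambda>f. \<lambda>i\<in>I. (f i - a i) / s"
  define c where "c = ennreal (1 / s ^ card I)"
  have g [measurable]: "?g \<in> measurable ?M ?M"
    by measurable
  have cs: "ennreal (s ^ card I) * c = 1"
    using s by (simp add: c_def flip: ennreal_mult)
  \<comment> \<open>The factor is moved to the other side, since the uniqueness rule for product measures characterises \<open>?M\<close> itself.\<close>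
  have "scale_measure c (distr ?M ?M ?g) = ?M"
  proof (rule PiM_eqI[OF fin])
    fix A :: "'i \<Rightarrow> real set" assume A: "\<And>i. i \<in> I \<Longrightarrow> A i \<in> sets lborel"
    have PA: "Pi\<^sub>E I A \<in> sets ?M"
      using A by (intro sets_PiM_I_finite fin)
    have "?g -` Pi\<^sub>E I A \<inter> space ?M = Pi\<^sub>E I (\<lambda>i. (\<lambda>x. (x - a i) / s) -` A i)"
      by (auto simp: space_PiM PiE_iff extensional_def)
    moreover have "(\<lambda>x. (x - a i) / s) -` A i \<in> sets lborel" if "i \<in> I" for i
      using A[OF that] measurable_sets[of "\<lambda>x. (x - a i) / s" borel borel "A i"] by simp
    ultimately have "emeasure (distr ?M ?M ?g) (Pi\<^sub>E I A) =
        (\<Prod>i\<in>I. emeasure lborel ((\<lambda>x. (x - a i) / s) -` A i))"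
      using PA fin by (simp add: emeasure_distr emeasure_PiM)
    also have "\<dots> = (\<Prod>i\<in>I. ennreal s * emeasure lborel (A i))"
      using A s by (intro prod.cong refl emeasure_lborel_affine_vimage) auto
    also have "\<dots> = ennreal (s ^ card I) * (\<Prod>i\<in>I. emeasure lborel (A i))"
      using s by (simp add: prod.distrib ennreal_power)
    finally show "emeasure (scale_measure c (distr ?M ?M ?g)) (Pi\<^sub>E I A) = (\<Prod>i\<in>I. emeasure lborel (A i))"
      using cs by (simp add: mult.assoc[symmetric] mult.commute[of c])
  qed simp
  from arg_cong[OF this, of "\<lambda>N. emeasure N X"]
  have "emeasure ?M X = c * emeasure (distr ?M ?M ?g) X"
    by simp
  also have "emeasure (distr ?M ?M ?g) X = emeasure ?M (?g -` X \<inter> space ?M)"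
    using X by (simp add: emeasure_distr)
  finally show ?thesis
    using cs by (simp add: mult.assoc[symmetric])
qed

lemma measurable_span_coords [measurable]:
  fixes B :: "'a::euclidean_space set"
  shows "(\<lambda>f. \<Sum>b\<in>B. f b *\<^sub>R b) \<in> borel_measurable (\<Pi>\<^sub>M b\<in>B. lborel)"
  by measurable

lemma sets_span_lborel [simp, measurable_cong]: "sets (span_lborel B) = sets borel"
  by (simp add: span_lborel_def)

lemma emeasure_span_lborel:
  fixes S :: "'a::euclidean_space set"
  assumes "S \<in> sets borel"
  shows "emeasure (span_lborel B) S =
    emeasure (\<Pi>\<^sub>M b\<in>B. lborel) ((\<lambda>f. \<Sum>b\<in>B. f b *\<^sub>R b) -` S \<inter> space (\<Pi>\<^sub>M b\<in>B. lborel))"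
  using assms by (simp add: span_lborel_def emeasure_distr)

lemma borel_affine_image:
  fixes S :: "'a::euclidean_space set"
  assumes "S \<in> sets borel" "0 < s"
  shows "(\<lambda>y. x + s *\<^sub>R y) ` S \<in> sets borel"
proof -
  have "(\<lambda>y. x + s *\<^sub>R y) ` S = (\<lambda>z. (1 / s) *\<^sub>R (z - x)) -` S \<inter> space borel"
    using assms(2) by (force simp: image_iff)
  also have "\<dots> \<in> sets borel"
    using assms(1) by (intro measurable_sets[of _ borel borel]) auto
  finally show ?thesis .
qed

lemma emeasure_span_lborel_affine:
  fixes B :: "'a::euclidean_space set"
  assumes fin: "finite B" and S: "S \<in> sets borel" and s: "0 < s" and x: "x \<in> span B"
  shows "emeasure (span_lborel B) ((\<lambda>y. x + s *\<^sub>R y) ` S) =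
    ennreal (s ^ card B) * emeasure (span_lborel B) S"
proof -
  let ?M = "\<Pi>\<^sub>M b\<in>B. lborel :: real measure"
  let ?p = "\<lambda>f. \<Sum>b\<in>B. f b *\<^sub>R b"
  obtain a where a: "x = (\<Sum>b\<in>B. a b *\<^sub>R b)"
    using x unfolding span_finite[OF fin] by blast
  let ?g = "\<lambda>f. \<lambda>b\<in>B. (f b - a b) / s"
  have pg: "?p f = x + s *\<^sub>R ?p (?g f)" for f
    using s by (simp add: a scaleR_sum_right flip: sum.distrib scaleR_add_left)
  have X: "?p -` S \<inter> space ?M \<in> sets ?M"
    using S by (intro measurable_sets[OF measurable_span_coords])
  have "?p f \<in> (\<lambda>y. x + s *\<^sub>R y) ` S \<longleftrightarrow> ?p (?g f) \<in> S" for f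
    unfolding pg[of f] using s by (auto simp: image_iff)
  then have "?p -` ((\<lambda>y. x + s *\<^sub>R y) ` S) \<inter> space ?M = ?g -` (?p -` S \<inter> space ?M) \<inter> space ?M"
    by (intro set_eqI) (simp add: space_PiM)
  then show ?thesis
    using emeasure_PiM_lborel_affine[OF fin s X, of a] S s
    by (simp add: emeasure_span_lborel borel_affine_image)
qed

lemma emeasure_PiM_lborel_cube:
  assumes "finite I" "0 \<le> r"
  shows "emeasure (\<Pi>\<^sub>M i\<in>I. lborel) (Pi\<^sub>E I (\<lambda>_. {-r..r})) = ennreal ((2 * r) ^ card I)"
proof -
  interpret product_sigma_finite "\<lambda>_::'i. lborel :: real measure"
    by standard
  show ?thesis
    using assms by (simp add: emeasure_PiM ennreal_power)
qed

lemma cube_in_PiM: "finite I \<Longrightarrow> Pi\<^sub>E I (\<lambda>_. {-r..r}) \<in> sets (\<Pi>\<^sub>M i\<in>I. lborel :: real measure)"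
  by (intro sets_PiM_I_finite) auto

lemma orthonormal_coord:
  assumes "pairwise orthogonal B" "\<And>b. b \<in> B \<Longrightarrow> norm b = 1" "finite B" "b \<in> B"
  shows "(\<Sum>b\<in>B. f b *\<^sub>R b) \<bullet> b = f b"
proof -
  have "(\<Sum>c\<in>B. f c *\<^sub>R c) \<bullet> b = (\<Sum>c\<in>B. if c = b then f b else 0)"
    unfolding inner_sum_left using assms
    by (intro sum.cong refl) (auto simp: pairwise_def orthogonal_def dot_square_norm)
  then show ?thesis
    using assms by simp
qed

lemma finite_orthonormal:
  fixes B :: "'a::euclidean_space set"
  assumes "pairwise orthogonal B" "\<And>b. b \<in> B \<Longrightarrow> norm b = 1"
  shows "finite B" "independent B"
proof -
  have "0 \<notin> B"
    using assms(2) by force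
  then show "independent B"
    using assms(1) pairwise_orthogonal_independent by blast
  then show "finite B"
    using independent_bound by blast
qed

text \<open>By orthonormality the coordinates of a vector are bounded by its norm, so a bounded set lies in a cube.\<close>

lemma emeasure_span_lborel_bounded:
  fixes B :: "'a::euclidean_space set"
  assumes B: "pairwise orthogonal B" "\<And>b. b \<in> B \<Longrightarrow> norm b = 1" and S: "bounded S" "S \<in> sets borel"
  shows "emeasure (span_lborel B) S < \<infinity>"
proof -
  note fin = finite_orthonormal(1)[OF B]
  let ?M = "\<Pi>\<^sub>M b\<in>B. lborel :: real measure"
  let ?p = "\<lambda>f. \<Sum>b\<in>B. f b *\<^sub>R b"
  obtain r where r: "0 < r" "\<And>x. x \<in> S \<Longrightarrow> norm x \<le> r"
    using S(1) unfolding bounded_pos by blast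
  have "?p -` S \<inter> space ?M \<subseteq> Pi\<^sub>E B (\<lambda>_. {-r..r})"
  proof (intro subsetI PiE_I)
    fix f b assume f: "f \<in> ?p -` S \<inter> space ?M" and b: "b \<in> B"
    have "\<bar>f b\<bar> \<le> norm (?p f) * norm b"
      using Cauchy_Schwarz_ineq2[of "?p f" b] orthonormal_coord[OF B fin b, of f] by simp
    also have "\<dots> \<le> r"
      using r(2)[of "?p f"] f B(2)[OF b] by simp
    finally show "f b \<in> {-r..r}"
      by auto
  qed (auto simp: space_PiM PiE_iff extensional_def)
  then have "emeasure (span_lborel B) S \<le> emeasure ?M (Pi\<^sub>E B (\<lambda>_. {-r..r}))"
    unfolding emeasure_span_lborel[OF S(2)] by (intro emeasure_mono cube_in_PiM fin)
  also have "\<dots> < \<infinity>"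
    using fin r(1) by (simp add: emeasure_PiM_lborel_cube)
  finally show ?thesis .
qed

text \<open>A small cube in coordinates lands in the given ball, because the norm of a vector is at most the sum of
  the absolute values of its coordinates.\<close>

lemma emeasure_span_lborel_pos:
  fixes B :: "'a::euclidean_space set"
  assumes B: "pairwise orthogonal B" "\<And>b. b \<in> B \<Longrightarrow> norm b = 1"
    and S: "S \<in> sets borel" "0 < e" "ball 0 e \<inter> span B \<subseteq> S"
  shows "0 < emeasure (span_lborel B) S"
proof -
  note fin = finite_orthonormal(1)[OF B]
  let ?M = "\<Pi>\<^sub>M b\<in>B. lborel :: real measure"
  let ?p = "\<lambda>f. \<Sum>b\<in>B. f b *\<^sub>R b"
  define r where "r = e / (real (card B) + 1)"
  have r: "0 < r" "real (card B) * r < e"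
    using S(2) by (auto simp: r_def field_simps)
  have "Pi\<^sub>E B (\<lambda>_. {-r..r}) \<subseteq> ?p -` S \<inter> space ?M"
  proof
    fix f assume f: "f \<in> Pi\<^sub>E B (\<lambda>_. {-r..r})"
    have "norm (?p f) \<le> (\<Sum>b\<in>B. r)"
      using f B(2) by (intro sum_norm_le) (fastforce simp: PiE_iff)
    then have "norm (?p f) < e"
      using r(2) by simp
    moreover have "?p f \<in> span B"
      by (intro span_sum span_scale span_base)
    ultimately show "f \<in> ?p -` S \<inter> space ?M"
      using S(3) f by (auto simp: space_PiM PiE_iff)
  qed
  moreover have "?p -` S \<inter> space ?M \<in> sets ?M"
    using S by (intro measurable_sets[OF measurable_span_coords])
  ultimately have "emeasure ?M (Pi\<^sub>E B (\<lambda>_. {-r..r})) \<le> emeasure (span_lborel B) S"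
    unfolding emeasure_span_lborel[OF S(1)] by (intro emeasure_mono)
  moreover have "0 < emeasure ?M (Pi\<^sub>E B (\<lambda>_. {-r..r}))"
    using fin r(1) by (simp add: emeasure_PiM_lborel_cube)
  ultimately show ?thesis
    by (metis order_less_le_trans)
qed

lemma measure_span_lborel_affine:
  fixes B :: "'a::euclidean_space set"
  assumes "finite B" "S \<in> sets borel" "0 < s" "x \<in> span B"
  shows "measure (span_lborel B) ((\<lambda>y. x + s *\<^sub>R y) ` S) = s ^ card B * measure (span_lborel B) S"
  using emeasure_span_lborel_affine[OF assms] assms(3)
  by (simp add: measure_def enn2real_mult)

lemma fmeasurable_span_lborel:
  fixes B :: "'a::euclidean_space set"
  assumes "pairwise orthogonal B" "\<And>b. b \<in> B \<Longrightarrow> norm b = 1" "bounded S" "S \<in> sets borel"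
  shows "S \<in> fmeasurable (span_lborel B)"
  using emeasure_span_lborel_bounded[OF assms] assms(4) by (intro fmeasurableI) auto

section \<open>Lattice bases\<close>

definition lattice_span :: "'a::real_vector set \<Rightarrow> 'a set" where
  "lattice_span C = {\<Sum>c\<in>C. of_int (k c) *\<^sub>R c | k :: 'a \<Rightarrow> int. True}"

lemma lattice_span_subset_span: "lattice_span C \<subseteq> span C"
  unfolding lattice_span_def by (safe, intro span_sum span_scale, rule span_base)

lemma subset_lattice_span:
  assumes "finite C"
  shows "C \<subseteq> lattice_span C"
proof
  fix b assume "b \<in> C"
  then have "b = (\<Sum>c\<in>C. of_int (if c = b then 1 else 0) *\<^sub>R c)"
    using assms by (simp add: if_distrib[of "\<lambda>x. x *\<^sub>R _"] if_distrib[of real_of_int] cong: if_cong)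
  then show "b \<in> lattice_span C"
    unfolding lattice_span_def by (intro CollectI exI[of _ "\<lambda>c. if c = b then 1 else 0"]) simp
qed

lemma of_int_scaleR_closed:
  fixes L :: "'a::real_vector set"
  assumes "0 \<in> L" and diff: "\<And>x y. x \<in> L \<Longrightarrow> y \<in> L \<Longrightarrow> x - y \<in> L" and "b \<in> L"
  shows "of_int k *\<^sub>R b \<in> L"
proof (induction k rule: int_induct[where k = 0])
  case (step1 i)
  have "0 - b \<in> L"
    using assms by blast
  from diff[OF step1.IH this] show ?case
    by (simp add: scaleR_add_left)
next
  case (step2 i)
  from diff[OF step2.IH \<open>b \<in> L\<close>] show ?case
    by (simp add: scaleR_diff_left)
qed (use assms in simp)

text \<open>Induction on the coordinates that are allowed to be nonzero. The elements of \<open>L\<close> with \<open>x $ i = 0\<close> have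
  a basis by induction. If they are not all of \<open>L\<close>, then an element \<open>b\<close> with smallest positive \<open>i\<close>-th
  coordinate completes it: division with remainder in this coordinate reduces every element of \<open>L\<close> to
  one with \<open>x $ i = 0\<close>, and \<open>b\<close> is independent of the rest because these have zero there.\<close>

lemma int_subgroup_has_basis:
  fixes L :: "(real ^ 'n) set"
  assumes "finite I" "L \<subseteq> int_points" "0 \<in> L" "\<And>x y. x \<in> L \<Longrightarrow> y \<in> L \<Longrightarrow> x - y \<in> L"
    "\<And>x i. x \<in> L \<Longrightarrow> i \<notin> I \<Longrightarrow> x $ i = 0"
  shows "\<exists>C. finite C \<and> independent C \<and> lattice_span C = L"
  using assms
proof (induction I arbitrary: L rule: finite_induct)
  case empty
  then have "L = {0}"
    by (auto simp: vec_eq_iff)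
  then show ?case
    by (intro exI[of _ "{}"]) (auto simp: lattice_span_def independent_empty)
next
  case (insert i I)
  define L' where "L' = {x \<in> L. x $ i = 0}"
  obtain C where C: "finite C" "independent C" "lattice_span C = L'"
  proof -
    have "x - y \<in> L'" if "x \<in> L'" "y \<in> L'" for x y
      using that insert.prems(3)[of x y] by (simp add: L'_def)
    moreover have "x $ j = 0" if "x \<in> L'" "j \<notin> I" for x j
      using that insert.prems(4)[of x j] by (cases "j = i") (auto simp: L'_def)
    moreover have "L' \<subseteq> int_points" "0 \<in> L'"
      using insert.prems(1,2) by (auto simp: L'_def)
    ultimately show ?thesis
      using insert.IH[of L'] that by blast
  qed
  show ?case
  proof (cases "\<exists>x\<in>L. x $ i \<noteq> 0")
    case False
    then have "L' = L"
      by (auto simp: L'_def)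
    then show ?thesis
      using C by blast
  next
    case True
    then obtain x where x: "x \<in> L" "x $ i \<noteq> 0" by blast
    have "0 - x \<in> L"
      using insert.prems x by blast
    then have "\<exists>x. x \<in> L \<and> x $ i > 0"
      using x by (metis diff_0 linorder_neqE_linordered_idom neg_0_less_iff_less vector_uminus_component)
    then obtain b where b: "b \<in> L" "b $ i > 0"
      and least: "\<And>y. y \<in> L \<Longrightarrow> y $ i > 0 \<Longrightarrow> nat \<lfloor>b $ i\<rfloor> \<le> nat \<lfloor>y $ i\<rfloor>"
      using ex_has_least_nat[of "\<lambda>x. x \<in> L \<and> x $ i > 0" _ "\<lambda>x. nat \<lfloor>x $ i\<rfloor>"] by blast
    have mult: "of_int k *\<^sub>R b \<in> L" for k
      by (rule of_int_scaleR_closed[OF insert.prems(2,3) b(1)])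
    have add: "x + y \<in> L" if "x \<in> L" "y \<in> L" for x y
      using insert.prems(3)[OF that(1) insert.prems(3)[OF insert.prems(2) that(2)]] by simp
    have reduce: "x - of_int \<lfloor>x $ i / b $ i\<rfloor> *\<^sub>R b \<in> L'" if x: "x \<in> L" for x
    proof -
      define y where "y = x - of_int \<lfloor>x $ i / b $ i\<rfloor> *\<^sub>R b"
      have y: "y \<in> L"
        unfolding y_def by (rule insert.prems(3)[OF x mult])
      have "y $ i / b $ i = frac (x $ i / b $ i)"
        using b(2) by (simp add: y_def frac_def field_simps)
      then have "0 \<le> y $ i" "y $ i < b $ i"
        using b(2) frac_ge_0[of "x $ i / b $ i"] frac_lt_1[of "x $ i / b $ i"]
        by (simp_all add: field_simps zero_le_divide_iff)
      moreover have "y $ i \<in> \<int>" "b $ i \<in> \<int>"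
        using y b(1) insert.prems(1) by (auto simp: int_points_def)
      then obtain k l where "y $ i = of_int k" "b $ i = of_int l"
        by (auto elim!: Ints_cases)
      ultimately have "y $ i = 0"
        using least[OF y] b(2) by (cases "k > 0") auto
      then show ?thesis
        using y by (simp add: L'_def y_def)
    qed
    have "span C \<subseteq> {x. x $ i = 0}"
    proof (rule span_minimal)
      show "C \<subseteq> {x. x $ i = 0}"
        using subset_lattice_span[OF C(1)] C(3) by (auto simp: L'_def)
    qed (auto simp: subspace_def)
    then have b_notin: "b \<notin> span C"
      using b(2) by auto
    then have bC: "b \<notin> C"
      using span_base by blast
    have split_sum: "(\<Sum>c\<in>insert b C. of_int (k c) *\<^sub>R c) = of_int (k b) *\<^sub>R b + (\<Sum>c\<in>C. of_int (k c) *\<^sub>R c)" for k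
      using C(1) bC by simp
    have "lattice_span (insert b C) = L"
    proof (intro equalityI subsetI)
      fix x assume "x \<in> lattice_span (insert b C)"
      then obtain k where "x = of_int (k b) *\<^sub>R b + (\<Sum>c\<in>C. of_int (k c) *\<^sub>R c)"
        unfolding lattice_span_def split_sum by blast
      moreover have "(\<Sum>c\<in>C. of_int (k c) *\<^sub>R c) \<in> L"
        using C(3) unfolding lattice_span_def L'_def by blast
      ultimately show "x \<in> L"
        using add mult by simp
    next
      fix x assume "x \<in> L"
      from reduce[OF this] obtain k where
        k: "x - of_int \<lfloor>x $ i / b $ i\<rfloor> *\<^sub>R b = (\<Sum>c\<in>C. of_int (k c) *\<^sub>R c)"
        using C(3) unfolding lattice_span_def by blast
      have "x = (\<Sum>c\<in>insert b C. of_int ((k(b := \<lfloor>x $ i / b $ i\<rfloor>)) c) *\<^sub>R c)"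
      proof -
        have "(\<Sum>c\<in>C. of_int ((k(b := \<lfloor>x $ i / b $ i\<rfloor>)) c) *\<^sub>R c) = (\<Sum>c\<in>C. of_int (k c) *\<^sub>R c)"
          using bC by (intro sum.cong) auto
        then show ?thesis
          unfolding split_sum using k by (simp add: algebra_simps)
      qed
      then show "x \<in> lattice_span (insert b C)"
        unfolding lattice_span_def by blast
    qed
    moreover have "independent (insert b C)"
      using independent_insertI[OF b_notin C(2)] .
    ultimately show ?thesis
      using C(1) by blast
  qed
qed

lemma direction_space_eq:
  assumes "a \<in> affine hull S"
  shows "direction_space S = (\<lambda>x. x - a) ` (affine hull S)"
proof (intro equalityI subsetI)
  fix d assume "d \<in> direction_space S"
  then obtain x y where d: "d = x - y" "x \<in> affine hull S" "y \<in> affine hull S"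
    unfolding direction_space_def by blast
  have "a + 1 *\<^sub>R (x - y) \<in> affine hull S"
    using mem_affine_3_minus[OF affine_affine_hull assms d(2,3)] .
  then show "d \<in> (\<lambda>x. x - a) ` (affine hull S)"
    using d(1) by (intro image_eqI[of _ _ "a + d"]) auto
qed (use assms in \<open>auto simp: direction_space_def\<close>)

lemma subspace_direction_space:
  assumes "S \<noteq> {}"
  shows "subspace (direction_space S)"
proof -
  obtain a where a: "a \<in> affine hull S"
    using assms hull_inc by (metis ex_in_conv)
  show ?thesis
    unfolding direction_space_eq[OF a] by (rule affine_diffs_subspace_subtract[OF affine_affine_hull a])
qed

lemma add_direction_space:
  assumes "a \<in> affine hull S" "d \<in> direction_space S"
  shows "a + d \<in> affine hull S"
  using assms by (auto simp: direction_space_eq[OF assms(1)])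

lemma lattice_differences:
  assumes "a \<in> affine hull P" "a \<in> int_points"
  shows "{x - y | x y. x \<in> affine hull P \<inter> int_points \<and> y \<in> affine hull P \<inter> int_points} =
    direction_space P \<inter> int_points"
proof (intro equalityI subsetI)
  fix d assume "d \<in> direction_space P \<inter> int_points"
  then have "a + d \<in> affine hull P \<inter> int_points"
    using add_direction_space[OF assms(1)] int_points_add[OF assms(2)] by blast
  then show "d \<in> {x - y | x y. x \<in> affine hull P \<inter> int_points \<and> y \<in> affine hull P \<inter> int_points}"
    using assms by (intro CollectI exI[of _ "a + d"] exI[of _ a]) auto
qed (auto simp: direction_space_def int_points_diff)

lemma lattice_basis_exists:
  fixes P :: "(real ^ 'n) set"
  assumes "a \<in> affine hull P" "a \<in> int_points"
  shows "\<exists>C. lattice_basis_of P C"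
proof -
  have "P \<noteq> {}"
    using assms(1) by auto
  note sub = subspace_direction_space[OF this]
  have "\<exists>C. finite C \<and> independent C \<and> lattice_span C = direction_space P \<inter> int_points"
    by (rule int_subgroup_has_basis[of UNIV])
      (auto simp: int_points_0 int_points_diff subspace_0[OF sub] subspace_diff[OF sub])
  then show ?thesis
    unfolding lattice_basis_of_def lattice_differences[OF assms] lattice_span_def by blast
qed

text \<open>The basis spans the whole direction space, as that is generated by differences of the integral
  vertices.\<close>

lemma lattice_basis_span:
  fixes P :: "(real ^ 'n) set"
  assumes P: "lattice_polytope P" and C: "lattice_basis_of P C"
  shows "finite C" "independent C" "lattice_span C = direction_space P \<inter> int_points"
    "span C = direction_space P"
proof -
  obtain S where S: "finite S" "S \<subseteq> int_points" "P = convex hull S" "S \<noteq> {}"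
    using lattice_polytope_hull[OF P] by blast
  have aff: "affine hull P = affine hull S"
    using S(3) affine_hull_convex_hull by blast
  obtain s0 where s0: "s0 \<in> S"
    using S(4) by blast
  have s0_aff: "s0 \<in> affine hull P"
    unfolding aff using s0 by (rule hull_inc)
  show ind: "independent C"
    using C by (simp add: lattice_basis_of_def)
  then show fin: "finite C"
    using independent_bound by blast
  have "s0 \<in> int_points"
    using s0 S(2) by blast
  from lattice_differences[OF s0_aff this]
  show L: "lattice_span C = direction_space P \<inter> int_points"
    using C unfolding lattice_basis_of_def lattice_span_def by argo
  have sub: "subspace (direction_space P)"
    using s0_aff by (intro subspace_direction_space) auto
  show "span C = direction_space P"
  proof
    show "span C \<subseteq> direction_space P"
      using L subset_lattice_span[OF fin] sub by (intro span_minimal) auto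
    have "affine hull S \<subseteq> (\<lambda>x. s0 + x) ` span C"
    proof (rule hull_minimal)
      show "S \<subseteq> (\<lambda>x. s0 + x) ` span C"
      proof
        fix s assume s: "s \<in> S"
        then have "s - s0 \<in> direction_space P"
          unfolding direction_space_eq[OF s0_aff] aff by (intro imageI hull_inc)
        then have "s - s0 \<in> span C"
          using L s s0 S(2) int_points_diff[of s s0] lattice_span_subset_span[of C] by blast
        then show "s \<in> (\<lambda>x. s0 + x) ` span C"
          by (intro image_eqI[of _ _ "s - s0"]) auto
      qed
      show "affine ((\<lambda>x. s0 + x) ` span C)"
        using affine_translation[of "span C" s0] subspace_imp_affine[OF subspace_span] by blast
    qed
    then show "direction_space P \<subseteq> span C"
      unfolding direction_space_eq[OF s0_aff] aff by auto
  qed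
qed

section \<open>Fundamental cells and volume bounds\<close>

text \<open>Unlike the closed parallelepipeds, the translates of this cell by the lattice are pairwise disjoint and
  so partition its span when \<open>C\<close> is independent.\<close>

definition half_open_cell :: "'a::real_vector set \<Rightarrow> 'a set" where
  "half_open_cell C = {\<Sum>c\<in>C. f c *\<^sub>R c | f. \<forall>c\<in>C. 0 \<le> f c \<and> f c < 1}"

lemma cell_subset_parallelepiped: "half_open_cell C \<subseteq> parallelepiped C"
  unfolding half_open_cell_def parallelepiped_def by (force intro: less_imp_le)

lemma parallelepiped_subset_span: "parallelepiped C \<subseteq> span C"
  unfolding parallelepiped_def by (safe, intro span_sum span_scale, rule span_base)

lemma zero_in_parallelepiped: "0 \<in> parallelepiped C"
  unfolding parallelepiped_def by (intro CollectI exI[of _ "\<lambda>_. 0"]) auto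

lemma subset_parallelepiped:
  assumes "finite C"
  shows "C \<subseteq> parallelepiped C"
proof
  fix b assume "b \<in> C"
  then have "b = (\<Sum>c\<in>C. (if c = b then 1 else 0) *\<^sub>R c)"
    using assms by (simp add: if_distrib[of "\<lambda>x. x *\<^sub>R _"] cong: if_cong)
  then show "b \<in> parallelepiped C"
    unfolding parallelepiped_def by (intro CollectI exI[of _ "\<lambda>c. if c = b then 1 else 0"]) simp
qed

lemma compact_parallelepiped:
  fixes C :: "'a::real_normed_vector set"
  assumes "finite C"
  shows "compact (parallelepiped C)"
  using assms
proof (induction C rule: finite_induct)
  case empty
  then show ?case
    by (simp add: parallelepiped_def)
next
  case (insert b C)
  have eq: "parallelepiped (insert b C) = {x + y | x y. x \<in> (\<lambda>s. s *\<^sub>R b) ` {0..1} \<and> y \<in> parallelepiped C}"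
  proof (intro equalityI subsetI)
    fix x assume "x \<in> parallelepiped (insert b C)"
    then obtain f where f: "x = f b *\<^sub>R b + (\<Sum>c\<in>C. f c *\<^sub>R c)" "\<forall>c\<in>insert b C. 0 \<le> f c \<and> f c \<le> 1"
      unfolding parallelepiped_def using insert.hyps by auto
    then show "x \<in> {x + y | x y. x \<in> (\<lambda>s. s *\<^sub>R b) ` {0..1} \<and> y \<in> parallelepiped C}"
      unfolding parallelepiped_def by fastforce
  next
    fix x assume "x \<in> {x + y | x y. x \<in> (\<lambda>s. s *\<^sub>R b) ` {0..1} \<and> y \<in> parallelepiped C}"
    then obtain s f where x: "x = s *\<^sub>R b + (\<Sum>c\<in>C. f c *\<^sub>R c)" "0 \<le> s" "s \<le> 1"
      and f: "\<forall>c\<in>C. 0 \<le> f c \<and> f c \<le> 1"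
      unfolding parallelepiped_def by auto
    have "(\<Sum>c\<in>C. (f(b := s)) c *\<^sub>R c) = (\<Sum>c\<in>C. f c *\<^sub>R c)"
      using insert.hyps by (intro sum.cong) auto
    then have "x = (\<Sum>c\<in>insert b C. (f(b := s)) c *\<^sub>R c)"
      using insert.hyps x(1) by simp
    then show "x \<in> parallelepiped (insert b C)"
      unfolding parallelepiped_def using x f by (intro CollectI exI[of _ "f(b := s)"]) auto
  qed
  have "compact ((\<lambda>s. s *\<^sub>R b) ` {0..1::real})"
    by (intro compact_continuous_image continuous_intros compact_Icc)
  then show ?case
    unfolding eq using insert.IH by (rule compact_sums)
qed

text \<open>Exhausting the half-open cell by shrunken closed parallelepipeds serves twice: it shows that the cell is
  a Borel set, and it bounds the measure of the cell from below by that of the closed parallelepiped.\<close>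

lemma half_open_cell_eq_Union:
  fixes C :: "'a::real_vector set"
  assumes "finite C"
  shows "half_open_cell C = (\<Union>n::nat. (\<lambda>x. (1 - 1 / real (n + 2)) *\<^sub>R x) ` parallelepiped C)"
proof (intro equalityI subsetI)
  fix x assume "x \<in> half_open_cell C"
  then obtain f where f: "x = (\<Sum>c\<in>C. f c *\<^sub>R c)" "\<And>c. c \<in> C \<Longrightarrow> 0 \<le> f c \<and> f c < 1"
    unfolding half_open_cell_def by blast
  \<comment> \<open>The shift by 2 makes every factor strictly positive, so that dividing by it is possible.\<close>
  have lim: "(\<lambda>n. 1 - 1 / real (n + 2)) \<longlonglongrightarrow> 1 - 0"
    by (intro tendsto_diff tendsto_const LIMSEQ_ignore_initial_segment[OF lim_1_over_n])
  have ev: "\<forall>\<^sub>F n in sequentially. \<forall>c\<in>C. f c < 1 - 1 / real (n + 2)"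
    using order_tendstoD(1)[OF lim] f(2) assms by (intro eventually_ball_finite) auto
  obtain n where n: "\<And>c. c \<in> C \<Longrightarrow> f c < 1 - 1 / real (n + 2)"
    using eventually_happens'[OF sequentially_bot ev] by blast
  define s where "s = 1 - 1 / real (n + 2)"
  have s: "0 < s"
    by (simp add: s_def field_simps)
  have "x = s *\<^sub>R (\<Sum>c\<in>C. (f c / s) *\<^sub>R c)"
    using s by (simp add: f(1) scaleR_sum_right)
  moreover have "(\<Sum>c\<in>C. (f c / s) *\<^sub>R c) \<in> parallelepiped C"
    unfolding parallelepiped_def
  proof (intro CollectI exI[of _ "\<lambda>c. f c / s"] conjI ballI refl)
    fix c assume c: "c \<in> C"
    show "0 \<le> f c / s" "f c / s \<le> 1"
      using f(2)[OF c] n[OF c, folded s_def] s by simp_all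
  qed
  ultimately show "x \<in> (\<Union>n::nat. (\<lambda>x. (1 - 1 / real (n + 2)) *\<^sub>R x) ` parallelepiped C)"
    unfolding s_def by blast
next
  fix x assume "x \<in> (\<Union>n::nat. (\<lambda>x. (1 - 1 / real (n + 2)) *\<^sub>R x) ` parallelepiped C)"
  then obtain n f where x: "x = (1 - 1 / real (n + 2)) *\<^sub>R (\<Sum>c\<in>C. f c *\<^sub>R c)"
    and f: "\<And>c. c \<in> C \<Longrightarrow> 0 \<le> f c \<and> f c \<le> 1"
    unfolding parallelepiped_def by blast
  define s where "s = 1 - 1 / real (n + 2)"
  have s: "0 < s" "s < 1"
    by (simp_all add: s_def field_simps)
  have "x = (\<Sum>c\<in>C. (s * f c) *\<^sub>R c)"
    by (simp add: x s_def scaleR_sum_right)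
  moreover have "0 \<le> s * f c \<and> s * f c < 1" if "c \<in> C" for c
  proof -
    have "s * f c \<le> s"
      using f[OF that] s by (intro mult_left_le) auto
    moreover have "0 \<le> s * f c"
      using f[OF that] s by simp
    ultimately show ?thesis
      using s by linarith
  qed
  ultimately show "x \<in> half_open_cell C"
    unfolding half_open_cell_def by (intro CollectI exI[of _ "\<lambda>c. s * f c"]) simp
qed

lemma borel_parallelepiped:
  fixes C :: "'a::euclidean_space set"
  assumes "finite C"
  shows "parallelepiped C \<in> sets borel"
  using compact_parallelepiped[OF assms] compact_imp_closed borel_closed by blast

lemma borel_half_open_cell:
  fixes C :: "'a::euclidean_space set"
  assumes "finite C"
  shows "half_open_cell C \<in> sets borel"
proof -
  have "(\<lambda>x. (1 - 1 / real (n + 2)) *\<^sub>R x) ` parallelepiped C \<in> sets borel" for n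
  proof -
    have pos: "0 < 1 - 1 / real (n + 2)"
      by (simp add: field_simps)
    show ?thesis
      using borel_affine_image[OF borel_parallelepiped[OF assms] pos, where x = 0] by simp
  qed
  then show ?thesis
    unfolding half_open_cell_eq_Union[OF assms] by blast
qed

lemma measure_half_open_cell:
  fixes B C :: "'a::euclidean_space set"
  assumes B: "pairwise orthogonal B" "\<And>b. b \<in> B \<Longrightarrow> norm b = 1" and C: "finite C"
  shows "measure (span_lborel B) (half_open_cell C) = measure (span_lborel B) (parallelepiped C)"
proof (rule antisym)
  let ?\<mu> = "measure (span_lborel B)"
  note fin = finite_orthonormal(1)[OF B]
  have bdd: "bounded (parallelepiped C)" "bounded (half_open_cell C)"
    using compact_imp_bounded[OF compact_parallelepiped[OF C]] cell_subset_parallelepiped bounded_subset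
    by blast+
  note fm = fmeasurable_span_lborel[OF B]
  show "?\<mu> (half_open_cell C) \<le> ?\<mu> (parallelepiped C)"
    by (intro measure_mono_fmeasurable cell_subset_parallelepiped fm bdd borel_parallelepiped C)
      (simp add: borel_half_open_cell C)
  have "(1 - 1 / real (n + 2)) ^ card B * ?\<mu> (parallelepiped C) \<le> ?\<mu> (half_open_cell C)" for n
  proof -
    have pos: "0 < 1 - 1 / real (n + 2)"
      by (simp add: field_simps)
    have "?\<mu> ((\<lambda>x. 0 + (1 - 1 / real (n + 2)) *\<^sub>R x) ` parallelepiped C) \<le> ?\<mu> (half_open_cell C)"
    proof (intro measure_mono_fmeasurable fm bdd borel_half_open_cell C)
      show "(\<lambda>x. 0 + (1 - 1 / real (n + 2)) *\<^sub>R x) ` parallelepiped C \<subseteq> half_open_cell C"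
        unfolding half_open_cell_eq_Union[OF C] by auto
      show "(\<lambda>x. 0 + (1 - 1 / real (n + 2)) *\<^sub>R x) ` parallelepiped C \<in> sets (span_lborel B)"
        using borel_affine_image[OF borel_parallelepiped[OF C] pos, where x = 0] by simp
    qed
    then show ?thesis
      using measure_span_lborel_affine[OF fin borel_parallelepiped[OF C] pos span_0] by simp
  qed
  moreover have "(\<lambda>n. (1 - 1 / real (n + 2)) ^ card B * ?\<mu> (parallelepiped C))
      \<longlonglongrightarrow> (1 - 0) ^ card B * ?\<mu> (parallelepiped C)"
    by (intro tendsto_intros LIMSEQ_ignore_initial_segment[OF lim_1_over_n])
  ultimately show "?\<mu> (parallelepiped C) \<le> ?\<mu> (half_open_cell C)"
    using LIMSEQ_le_const2 by (metis (no_types, lifting) diff_zero mult_1 power_one)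
qed

text \<open>Rounding the coordinates of \<open>p\<close> down gives the lattice point.\<close>

lemma half_open_cells_cover:
  assumes "finite C" "p \<in> span C"
  obtains l where "l \<in> lattice_span C" "p - l \<in> half_open_cell C"
proof -
  obtain u where u: "p = (\<Sum>c\<in>C. u c *\<^sub>R c)"
    using assms(2) unfolding span_finite[OF assms(1)] by blast
  let ?l = "\<Sum>c\<in>C. of_int \<lfloor>u c\<rfloor> *\<^sub>R c"
  have "?l \<in> lattice_span C"
    unfolding lattice_span_def by (intro CollectI exI[of _ "\<lambda>c. \<lfloor>u c\<rfloor>"]) simp
  moreover have "p - ?l = (\<Sum>c\<in>C. frac (u c) *\<^sub>R c)"
    by (simp add: u frac_def scaleR_diff_left sum_subtractf)
  then have "p - ?l \<in> half_open_cell C"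
    unfolding half_open_cell_def by (intro CollectI exI[of _ "\<lambda>c. frac (u c)"]) (simp add: frac_lt_1)
  ultimately show thesis
    by (rule that)
qed

lemma half_open_cells_disjoint:
  assumes C: "finite C" "independent C" and l: "l \<in> lattice_span C" "l' \<in> lattice_span C"
    and p: "p - l \<in> half_open_cell C" "p - l' \<in> half_open_cell C"
  shows "l = l'"
proof -
  obtain k k' where k: "l = (\<Sum>c\<in>C. of_int (k c) *\<^sub>R c)" "l' = (\<Sum>c\<in>C. of_int (k' c) *\<^sub>R c)"
    using l unfolding lattice_span_def by blast
  obtain f where f: "p - l = (\<Sum>c\<in>C. f c *\<^sub>R c)" "\<And>c. c \<in> C \<Longrightarrow> 0 \<le> f c \<and> f c < 1"
    using p(1) unfolding half_open_cell_def by blast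
  obtain g where g: "p - l' = (\<Sum>c\<in>C. g c *\<^sub>R c)" "\<And>c. c \<in> C \<Longrightarrow> 0 \<le> g c \<and> g c < 1"
    using p(2) unfolding half_open_cell_def by blast
  have "(\<Sum>c\<in>C. (of_int (k c) + f c - (of_int (k' c) + g c)) *\<^sub>R c) = (l + (p - l)) - (l' + (p - l'))"
    unfolding f(1) g(1) unfolding k scaleR_diff_left scaleR_add_left sum.distrib sum_subtractf ..
  then have zero: "(\<Sum>c\<in>C. (of_int (k c) + f c - (of_int (k' c) + g c)) *\<^sub>R c) = 0"
    by simp
  have "k c = k' c" if "c \<in> C" for c
  proof -
    have "of_int (k c) + f c - (of_int (k' c) + g c) = 0"
      using independentD[OF C(2,1) subset_refl zero that] .
    then have "\<bar>real_of_int (k c) - real_of_int (k' c)\<bar> < 1"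
      using f(2)[OF that] g(2)[OF that] by linarith
    then show ?thesis by linarith
  qed
  then show ?thesis
    unfolding k by (intro sum.cong) auto
qed

lemma convex_dilate_add:
  assumes K: "convex K" "x \<in> K" "y \<in> K" and "0 \<le> s" "0 < r"
  obtains z where "z \<in> K" "s *\<^sub>R x + r *\<^sub>R y = (s + r) *\<^sub>R z"
proof
  show "(s / (s + r)) *\<^sub>R x + (r / (s + r)) *\<^sub>R y \<in> K"
    using assms by (intro convexD) (auto simp flip: add_divide_distrib)
  show "s *\<^sub>R x + r *\<^sub>R y = (s + r) *\<^sub>R ((s / (s + r)) *\<^sub>R x + (r / (s + r)) *\<^sub>R y)"
    using assms by (simp add: scaleR_add_right)
qed

text \<open>The cells attached to the lattice points of \<open>y + t K\<close> form a set \<open>U\<close> of volume \<open>N vol D\<close>. The choice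
  of \<open>r\<close> makes \<open>D\<close> and \<open>- D\<close> subsets of \<open>r K\<close>. With \<open>t K + r K = (t + r) K\<close>, which is where
  convexity enters, it follows that \<open>U\<close> lies in \<open>y + (t + r) K\<close>; and a point of \<open>y + (t - r) K\<close> lies in the
  cell of a lattice point that is at most an element of \<open>- D\<close> away, hence in \<open>y + t K\<close>.\<close>

lemma lattice_points_bounds:
  fixes K :: "(real ^ 'n) set"
  assumes B: "pairwise orthogonal B" "\<And>b. b \<in> B \<Longrightarrow> norm b = 1"
    and C: "finite C" "independent C" "span C = span B" "lattice_span C \<subseteq> int_points"
    and K: "compact K" "convex K" "K \<subseteq> span B" "ball 0 e \<inter> span B \<subseteq> K"
    and r: "0 < r" "\<And>d. d \<in> half_open_cell C \<Longrightarrow> norm d < r * e"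
    and y: "y \<in> span B" and t: "r < t"
  defines "N \<equiv> real (card (lattice_span C \<inter> (\<lambda>x. y + t *\<^sub>R x) ` K))"
  shows "(t - r) ^ card B * measure (span_lborel B) K \<le> N * measure (span_lborel B) (half_open_cell C)"
    and "N * measure (span_lborel B) (half_open_cell C) \<le> (t + r) ^ card B * measure (span_lborel B) K"
proof -
  let ?\<mu> = "measure (span_lborel B)" and ?D = "half_open_cell C"
  define F where "F = lattice_span C \<inter> (\<lambda>x. y + t *\<^sub>R x) ` K"
  define U where "U = (\<Union>l\<in>F. (\<lambda>x. l + 1 *\<^sub>R x) ` ?D)"
  note finB = finite_orthonormal(1)[OF B]
  have D_span: "?D \<subseteq> span B"
    using cell_subset_parallelepiped parallelepiped_subset_span C(3) by blast
  have cK: "compact ((\<lambda>x. y + s *\<^sub>R x) ` K)" for s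
    by (intro compact_continuous_image continuous_intros K)
  have finF: "finite F"
    unfolding F_def using C(4)
    by (intro finite_subset[OF _ finite_int_points_bounded[OF compact_imp_bounded[OF cK[of t]]]]) auto
  have F_span: "F \<subseteq> span B"
    using lattice_span_subset_span[of C] C(3) by (auto simp: F_def)
  have bK: "K \<in> sets borel" and bD: "?D \<in> sets borel"
    using K(1) compact_imp_closed borel_closed borel_half_open_cell[OF C(1)] by blast+
  have bdD: "bounded ?D"
    using r(2) unfolding bounded_iff by (meson less_imp_le)
  have in_K: "(1 / r) *\<^sub>R d \<in> K" "(- 1 / r) *\<^sub>R d \<in> K" if "d \<in> ?D" for d
  proof -
    have "a *\<^sub>R d \<in> K" if "\<bar>a\<bar> = 1 / r" for a
    proof -
      have "norm (a *\<^sub>R d) < e"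
        using r(2)[OF \<open>d \<in> ?D\<close>] r(1) that by (simp add: pos_divide_less_eq mult.commute)
      moreover have "a *\<^sub>R d \<in> span B"
        using \<open>d \<in> ?D\<close> D_span by (intro span_scale) auto
      ultimately show ?thesis
        using K(4) by auto
    qed
    from this[of "1 / r"] this[of "- 1 / r"] show "(1 / r) *\<^sub>R d \<in> K" "(- 1 / r) *\<^sub>R d \<in> K"
      using r(1) by auto
  qed
  have upper: "U \<subseteq> (\<lambda>x. y + (t + r) *\<^sub>R x) ` K"
  proof
    fix p assume "p \<in> U"
    then obtain k d where p: "p = y + t *\<^sub>R k + d" "k \<in> K" "d \<in> ?D"
      unfolding U_def F_def by auto
    obtain z where "z \<in> K" "t *\<^sub>R k + r *\<^sub>R ((1 / r) *\<^sub>R d) = (t + r) *\<^sub>R z"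
      using convex_dilate_add[OF K(2) p(2) in_K(1)[OF p(3)], of t r] r(1) t by auto
    then show "p \<in> (\<lambda>x. y + (t + r) *\<^sub>R x) ` K"
      using p(1) r(1) by (intro image_eqI[of _ _ z]) auto
  qed
  have lower: "(\<lambda>x. y + (t - r) *\<^sub>R x) ` K \<subseteq> U"
  proof
    fix p assume "p \<in> (\<lambda>x. y + (t - r) *\<^sub>R x) ` K"
    then obtain k where p: "p = y + (t - r) *\<^sub>R k" "k \<in> K"
      by blast
    then have "p \<in> span C"
      using y K(3) C(3) by (auto intro!: span_add span_scale)
    then obtain l where l: "l \<in> lattice_span C" "p - l \<in> ?D"
      using half_open_cells_cover[OF C(1)] by blast
    obtain z where z: "z \<in> K" "(t - r) *\<^sub>R k + r *\<^sub>R ((- 1 / r) *\<^sub>R (p - l)) = (t - r + r) *\<^sub>R z"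
      using convex_dilate_add[OF K(2) p(2) in_K(2)[OF l(2)], of "t - r" r] r(1) t by auto
    then have "l = y + t *\<^sub>R z"
      using p(1) r(1) by (simp add: algebra_simps)
    then have "l \<in> F"
      using l(1) z(1) unfolding F_def by blast
    then show "p \<in> U"
      unfolding U_def using l(2) by (intro UN_I[of l] image_eqI[of _ _ "p - l"]) auto
  qed
  have bl: "(\<lambda>x. l + 1 *\<^sub>R x) ` ?D \<in> sets borel" for l
    by (rule borel_affine_image[OF bD]) simp
  have fm: "(\<lambda>x. l + 1 *\<^sub>R x) ` ?D \<in> fmeasurable (span_lborel B)" for l
  proof -
    have "(\<lambda>x. l + 1 *\<^sub>R x) = (+) l"
      by (rule ext) simp
    then show ?thesis
      using bounded_translation[OF bdD, of l] bl[of l]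
      by (intro fmeasurable_span_lborel[OF B]) simp_all
  qed
  have "?\<mu> U = (\<Sum>l\<in>F. ?\<mu> ((\<lambda>x. l + 1 *\<^sub>R x) ` ?D))"
    unfolding U_def
  proof (rule measure_finite_Union[OF finF])
    show "disjoint_family_on (\<lambda>l. (\<lambda>x. l + 1 *\<^sub>R x) ` ?D) F"
      unfolding disjoint_family_on_def
    proof (intro ballI impI)
      fix l l' assume ll: "l \<in> F" "l' \<in> F" "l \<noteq> l'"
      show "(\<lambda>x. l + 1 *\<^sub>R x) ` ?D \<inter> (\<lambda>x. l' + 1 *\<^sub>R x) ` ?D = {}"
      proof (rule ccontr)
        assume "(\<lambda>x. l + 1 *\<^sub>R x) ` ?D \<inter> (\<lambda>x. l' + 1 *\<^sub>R x) ` ?D \<noteq> {}"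
        then obtain a b where ab: "a \<in> ?D" "b \<in> ?D" "l + a = l' + b"
          by auto
        have "(l + a) - l \<in> ?D"
          using ab(1) by simp
        moreover have "(l + a) - l' \<in> ?D"
          unfolding ab(3) using ab(2) by simp
        ultimately show False
          using half_open_cells_disjoint[OF C(1,2)] ll unfolding F_def by blast
      qed
    qed
  qed (use bl fmeasurableD2[OF fm] in auto)
  also have "\<dots> = (\<Sum>l\<in>F. ?\<mu> ?D)"
    using F_span by (intro sum.cong refl) (subst measure_span_lborel_affine[OF finB bD], auto)
  finally have U: "?\<mu> U = N * ?\<mu> ?D"
    by (simp add: N_def F_def)
  have bU: "U \<in> sets borel"
    unfolding U_def using finF bl by (intro sets.finite_UN) auto
  have sc: "?\<mu> ((\<lambda>x. y + s *\<^sub>R x) ` K) = s ^ card B * ?\<mu> K"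
    "(\<lambda>x. y + s *\<^sub>R x) ` K \<in> fmeasurable (span_lborel B)" if "0 < s" for s
    using measure_span_lborel_affine[OF finB bK that y]
      fmeasurable_span_lborel[OF B compact_imp_bounded[OF cK] borel_affine_image[OF bK that]] by auto
  have "bounded U"
    using upper compact_imp_bounded[OF cK] bounded_subset by blast
  then have fU: "U \<in> fmeasurable (span_lborel B)"
    using fmeasurable_span_lborel[OF B _ bU] by blast
  show "(t - r) ^ card B * ?\<mu> K \<le> N * ?\<mu> ?D"
    using measure_mono_fmeasurable[OF lower _ fU] sc[of "t - r"] t U by (auto simp: fmeasurableD)
  show "N * ?\<mu> ?D \<le> (t + r) ^ card B * ?\<mu> K"
    using measure_mono_fmeasurable[OF upper _ sc(2)] sc(1)[of "t + r"] t r(1) U bU by auto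
qed

section \<open>Relative volume as the growth rate of the count\<close>

lemma orthonormal_basis_some:
  fixes V :: "'a::euclidean_space set"
  assumes "subspace V"
  shows "orthonormal_basis_of V (SOME B. orthonormal_basis_of V B)"
proof (rule someI_ex)
  obtain B where "pairwise orthogonal B" "\<And>x. x \<in> B \<Longrightarrow> norm x = 1" "span B = V"
    using orthonormal_basis_subspace[OF assms] by metis
  then show "\<exists>B. orthonormal_basis_of V B"
    unfolding orthonormal_basis_of_def by blast
qed

text \<open>The measure on the direction space is invariant under translations by its own vectors, so every
  origin in the affine hull gives the same value.\<close>

lemma affine_volume_origin:
  fixes S :: "'a::euclidean_space set"
  assumes b: "b \<in> affine hull S" and S: "S \<in> sets borel"
  shows "affine_volume S =
    measure (span_lborel (SOME B. orthonormal_basis_of (direction_space S) B)) ((\<lambda>x. x - b) ` S)"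
proof -
  define B where "B = (SOME B. orthonormal_basis_of (direction_space S) B)"
  define a where "a = (SOME a. a \<in> affine hull S)"
  have a: "a \<in> affine hull S"
    unfolding a_def using b by (rule someI)
  have "S \<noteq> {}"
    using b by auto
  then have "orthonormal_basis_of (direction_space S) B"
    unfolding B_def by (intro orthonormal_basis_some subspace_direction_space)
  then have B: "pairwise orthogonal B" "\<And>b. b \<in> B \<Longrightarrow> norm b = 1" "span B = direction_space S"
    by (auto simp: orthonormal_basis_of_def)
  have "b - a \<in> span B"
    unfolding B(3) using a b by (auto simp: direction_space_def)
  moreover have "(\<lambda>x. x - b) ` S \<in> sets borel"
    using borel_affine_image[OF S, of 1 "- b"] by simp
  ultimately have "measure (span_lborel B) ((\<lambda>y. (b - a) + 1 *\<^sub>R y) ` (\<lambda>x. x - b) ` S) =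
      measure (span_lborel B) ((\<lambda>x. x - b) ` S)"
    by (subst measure_span_lborel_affine[OF finite_orthonormal(1)[OF B(1,2)]]) auto
  moreover have "(\<lambda>y. (b - a) + 1 *\<^sub>R y) ` (\<lambda>x. x - b) ` S = (\<lambda>x. x - a) ` S"
    unfolding image_image by simp
  ultimately show ?thesis
    unfolding affine_volume_def Let_def a_def[symmetric] B_def[symmetric] by simp
qed

lemma affine_hull_parallelepiped:
  assumes "finite C"
  shows "affine hull (parallelepiped C) = span C"
proof -
  have "affine hull (parallelepiped C) = span (parallelepiped C)"
    by (intro affine_hull_span_0 hull_inc zero_in_parallelepiped)
  also have "\<dots> = span C"
    using span_mono[OF subset_parallelepiped[OF assms]] span_minimal[OF parallelepiped_subset_span] by auto
  finally show ?thesis .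
qed

lemma direction_space_parallelepiped:
  fixes C :: "'a::euclidean_space set"
  assumes "finite C"
  shows "direction_space (parallelepiped C) = span C"
  using direction_space_eq[of 0 "parallelepiped C"] affine_hull_parallelepiped[OF assms]
  by (simp add: span_zero)

lemma power_shift_ratio_tendsto: "(\<lambda>t. (real t + a) ^ m / real t ^ m) \<longlonglongrightarrow> 1"
proof -
  have "(\<lambda>t. (1 + a / real t) ^ m) \<longlonglongrightarrow> (1 + 0) ^ m"
    by (intro tendsto_intros lim_const_over_n)
  moreover have "\<forall>\<^sub>F t in sequentially. (1 + a / real t) ^ m = (real t + a) ^ m / real t ^ m"
    using eventually_gt_at_top[of 0]
    by eventually_elim (simp add: field_simps flip: power_divide)
  ultimately show ?thesis
    by (simp add: tendsto_cong)
qed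

text \<open>The hypothesis on \<open>z\<close> says that the affine subspaces \<open>c + t (aff P)\<close> contain integer points.
  Subtracting the integer point \<open>z + t v\<close>, for an integral vertex \<open>v\<close>, moves the count into the direction space,
  and a relative interior point \<open>q\<close> of \<open>P\<close> as the new origin provides the ball that the volume bounds
  require. Both volumes in \<open>relvol P\<close> refer to the same orthonormal basis, since \<open>P\<close> and the fundamental
  parallelepiped have the same direction space.\<close>

lemma lattice_count_tendsto_relvol:
  fixes P :: "(real ^ 'n) set"
  assumes P: "lattice_polytope P" and z: "z \<in> int_points" "z - c \<in> direction_space P"
  shows "(\<lambda>t. real (lattice_count P c t) / real t ^ nat (aff_dim P)) \<longlonglongrightarrow> relvol P"
    and "0 < relvol P"
proof -
  obtain S where S: "finite S" "S \<subseteq> int_points" "P = convex hull S" "S \<noteq> {}"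
    by (rule lattice_polytope_hull[OF P])
  then obtain v where "v \<in> S"
    by blast
  then have v: "v \<in> P" "v \<in> int_points"
    using S by (auto intro: hull_inc)
  have "P \<noteq> {}" "convex P" "compact P"
    using v S by (auto simp: finite_imp_compact_convex_hull)
  define V where "V = direction_space P"
  define C where "C = (SOME C. lattice_basis_of P C)"
  define B where "B = (SOME B. orthonormal_basis_of V B)"
  have "lattice_basis_of P C"
    unfolding C_def by (intro someI_ex[OF lattice_basis_exists[OF hull_inc[OF v(1)] v(2)]])
  note C = lattice_basis_span[OF P this, folded V_def]
  have subV: "subspace V"
    unfolding V_def by (rule subspace_direction_space[OF \<open>P \<noteq> {}\<close>])
  have "orthonormal_basis_of V B"
    unfolding B_def by (rule orthonormal_basis_some[OF subV])
  then have B: "pairwise orthogonal B" "\<And>b. b \<in> B \<Longrightarrow> norm b = 1" "span B = V"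
    by (auto simp: orthonormal_basis_of_def)
  let ?\<mu> = "measure (span_lborel B)"
  obtain q where "q \<in> rel_interior P"
    using rel_interior_eq_empty[OF \<open>convex P\<close>] \<open>P \<noteq> {}\<close> by blast
  then obtain e where q: "q \<in> P" and e: "0 < e" "ball q e \<inter> affine hull P \<subseteq> P"
    unfolding mem_rel_interior_ball by blast
  have q_aff: "q \<in> affine hull P" and v_aff: "v \<in> affine hull P"
    using q v by (auto intro: hull_inc)
  define K where "K = (\<lambda>x. x - q) ` P"
  have K: "compact K" "convex K" "K \<subseteq> span B" "ball 0 e \<inter> span B \<subseteq> K"
  proof -
    show "compact K" "convex K"
      unfolding K_def using \<open>compact P\<close> \<open>convex P\<close>
      by (simp_all add: compact_translation_subtract convex_translation_subtract)
    show "K \<subseteq> span B"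
      unfolding K_def B(3) V_def direction_space_eq[OF q_aff] by (intro image_mono hull_subset)
    show "ball 0 e \<inter> span B \<subseteq> K"
    proof
      fix x assume x: "x \<in> ball 0 e \<inter> span B"
      then have "q + x \<in> affine hull P"
        using add_direction_space[OF q_aff] B(3) V_def by blast
      then have "q + x \<in> P"
        using x e(2) by (auto simp: dist_norm)
      then show "x \<in> K"
        unfolding K_def by (intro image_eqI[of _ _ "q + x"]) auto
    qed
  qed
  have bK: "K \<in> sets borel" and bP: "P \<in> sets borel"
    using K(1) \<open>compact P\<close> compact_imp_closed borel_closed by blast+
  have "dim V = card B"
    using dim_span_eq_card_independent[OF finite_orthonormal(2)[OF B(1,2)]] B(3) by simp
  moreover have "aff_dim P = int (dim V)"
    using aff_dim_eq_dim_subtract[of q "affine hull P"] q_aff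
    by (simp add: V_def direction_space_eq[OF q_aff])
  ultimately have m: "nat (aff_dim P) = card B"
    by simp
  have relvol: "relvol P = ?\<mu> K / ?\<mu> (half_open_cell C)"
  proof -
    have "affine_volume P = ?\<mu> K"
      unfolding affine_volume_origin[OF q_aff bP] K_def B_def V_def ..
    moreover have "affine_volume (parallelepiped C) = ?\<mu> (parallelepiped C)"
    proof -
      have "0 \<in> affine hull (parallelepiped C)"
        by (intro hull_inc zero_in_parallelepiped)
      from affine_volume_origin[OF this borel_parallelepiped[OF C(1)]] show ?thesis
        unfolding direction_space_parallelepiped[OF C(1)] C(4) B_def by simp
    qed
    ultimately show ?thesis
      unfolding relvol_def C_def[symmetric] using measure_half_open_cell[OF B(1,2) C(1)] by simp
  qed
  obtain R where R: "0 < R" "\<And>d. d \<in> half_open_cell C \<Longrightarrow> norm d \<le> R"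
    using compact_imp_bounded[OF compact_parallelepiped[OF C(1)]] cell_subset_parallelepiped[of C]
    unfolding bounded_pos by blast
  \<comment> \<open>The summand 1 makes the bound \<open>norm d < r * e\<close> strict on the cell.\<close>
  define r where "r = (R + 1) / e"
  have r: "0 < r" "\<And>d. d \<in> half_open_cell C \<Longrightarrow> norm d < r * e"
    using R e(1) by (fastforce simp: r_def)+
  define y where "y t = c - z + real t *\<^sub>R (q - v)" for t :: nat
  have y: "y t \<in> span B" for t
  proof -
    have "q - v \<in> V"
      unfolding V_def direction_space_def using q_aff v_aff by blast
    moreover have "- (z - c) \<in> V"
      using z(2) subV V_def subspace_neg by blast
    ultimately show ?thesis
      unfolding y_def B(3) using subV by (metis minus_diff_eq subspace_add subspace_scale)
  qed
  have count: "lattice_count P c t = card (lattice_span C \<inter> (\<lambda>x. y t + real t *\<^sub>R x) ` K)" for t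
  proof -
    define s where "s = z + real t *\<^sub>R v"
    have s: "s \<in> int_points"
      unfolding s_def using z(1) v(2) by (intro int_points_add int_points_scaleR) auto
    have eq: "y t + real t *\<^sub>R (x - q) = (c + real t *\<^sub>R x) - s" for x
      by (simp add: y_def s_def algebra_simps)
    have "(\<lambda>x. y t + real t *\<^sub>R x) ` K \<subseteq> V"
      unfolding B(3)[symmetric] using K(3) y[of t] by (auto intro!: span_add span_scale)
    then have "lattice_span C \<inter> (\<lambda>x. y t + real t *\<^sub>R x) ` K =
        (\<lambda>x. x - s) ` ((\<lambda>x. c + real t *\<^sub>R x) ` P \<inter> int_points)"
      unfolding C(3) K_def image_image eq
      using int_points_diff[OF _ s] int_points_add[OF _ s] by fastforce
    then show ?thesis
      unfolding lattice_count_def by (simp add: card_image inj_on_def)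
  qed
  let ?N = "\<lambda>t. real (lattice_count P c t)"
  have bounds: "(real t - r) ^ card B * ?\<mu> K \<le> ?N t * ?\<mu> (half_open_cell C)"
    "?N t * ?\<mu> (half_open_cell C) \<le> (real t + r) ^ card B * ?\<mu> K" if "r < real t" for t
    unfolding count
    using lattice_points_bounds[OF B(1,2) C(1,2) _ _ K r y that] C(3,4) B(3) by auto
  have "0 < emeasure (span_lborel B) K"
    using emeasure_span_lborel_pos[OF B(1,2) bK e(1) K(4)] .
  moreover have "emeasure (span_lborel B) K < \<infinity>"
    using emeasure_span_lborel_bounded[OF B(1,2) compact_imp_bounded[OF K(1)] bK] .
  ultimately have K_pos: "0 < ?\<mu> K"
    unfolding measure_def by (simp add: enn2real_positive_iff)
  \<comment> \<open>The cell has positive volume, since otherwise the lower bound would force \<open>K\<close> to have volume zero.\<close>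
  obtain t0 :: nat where t0: "r < real t0"
    using reals_Archimedean2 by blast
  have "0 < (real t0 - r) ^ card B * ?\<mu> K"
    using t0 K_pos by simp
  then have "0 < ?N t0 * ?\<mu> (half_open_cell C)"
    using bounds(1)[OF t0] by linarith
  then have D_pos: "0 < ?\<mu> (half_open_cell C)"
    by (simp add: zero_less_mult_iff)
  show "0 < relvol P"
    unfolding relvol using K_pos D_pos by simp
  have ev: "\<forall>\<^sub>F t in sequentially. r < real t \<and> 0 < t"
    using t0 by (intro eventually_sequentiallyI[of "Suc t0"]) auto
  show "(\<lambda>t. ?N t / real t ^ nat (aff_dim P)) \<longlonglongrightarrow> relvol P"
    unfolding m
  proof (rule tendsto_sandwich)
    show "\<forall>\<^sub>F t in sequentially. (real t + (- r)) ^ card B / real t ^ card B * relvol P \<le> ?N t / real t ^ card B"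
      using ev
    proof eventually_elim
      case (elim t)
      then show ?case
        using bounds(1)[of t] D_pos unfolding relvol by (simp add: field_simps)
    qed
    show "\<forall>\<^sub>F t in sequentially. ?N t / real t ^ card B \<le> (real t + r) ^ card B / real t ^ card B * relvol P"
      using ev
    proof eventually_elim
      case (elim t)
      then show ?case
        using bounds(2)[of t] D_pos unfolding relvol by (simp add: field_simps)
    qed
    have "(\<lambda>t. (real t + a) ^ card B / real t ^ card B * relvol P) \<longlonglongrightarrow> 1 * relvol P" for a
      by (intro tendsto_mult power_shift_ratio_tendsto tendsto_const)
    then show "(\<lambda>t. (real t + (- r)) ^ card B / real t ^ card B * relvol P) \<longlonglongrightarrow> relvol P"
      "(\<lambda>t. (real t + r) ^ card B / real t ^ card B * relvol P) \<longlonglongrightarrow> relvol P"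
      by (simp_all only: mult_1)
  qed
qed

section \<open>Polynomials determined by their growth\<close>

text \<open>Dividing by \<open>t\<close> to the power \<open>degree p\<close> gives a nonzero limit, the leading coefficient. A larger exponent
  gives the limit zero and so does not yield \<open>r\<close>; with a smaller one, convergence to \<open>r\<close> would make the
  leading coefficient zero.\<close>

lemma rat_poly_growth:
  fixes p :: "rat poly"
  assumes lim: "(\<lambda>t. real_of_rat (poly p (of_nat t)) / real t ^ m) \<longlonglongrightarrow> r" and r: "r \<noteq> 0"
  shows "degree p = m \<and> real_of_rat (lead_coeff p) = r"
proof -
  define n where "n = degree p"
  let ?f = "\<lambda>t. real_of_rat (poly p (of_nat t))"
  have inv_power: "(\<lambda>t. (1 / real t) ^ k) \<longlonglongrightarrow> 0" if "0 < k" for k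
    using that by (simp add: lim_1_over_n)
  have lead: "(\<lambda>t. ?f t / real t ^ n) \<longlonglongrightarrow> real_of_rat (lead_coeff p)"
  proof -
    have "(\<lambda>t. \<Sum>i\<le>n. real_of_rat (coeff p i) * (1 / real t) ^ (n - i)) \<longlonglongrightarrow>
        (\<Sum>i\<le>n. real_of_rat (coeff p i) * (if i = n then 1 else 0))"
    proof (intro tendsto_sum tendsto_mult tendsto_const)
      fix i assume "i \<in> {..n}"
      then show "(\<lambda>t. (1 / real t) ^ (n - i)) \<longlonglongrightarrow> (if i = n then 1 else 0)"
        using inv_power[of "n - i"] by (cases "i = n") auto
    qed
    also have "(\<Sum>i\<le>n. real_of_rat (coeff p i) * (if i = n then 1 else 0)) = real_of_rat (lead_coeff p)"
      by (simp add: n_def if_distrib[of "\<lambda>x. _ * x"] cong: if_cong)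
    finally have *: "(\<lambda>t. \<Sum>i\<le>n. real_of_rat (coeff p i) * (1 / real t) ^ (n - i)) \<longlonglongrightarrow>
        real_of_rat (lead_coeff p)" .
    have "\<forall>\<^sub>F t in sequentially. (\<Sum>i\<le>n. real_of_rat (coeff p i) * (1 / real t) ^ (n - i)) = ?f t / real t ^ n"
      using eventually_gt_at_top[of 0]
    proof eventually_elim
      case (elim t)
      have "?f t / real t ^ n = (\<Sum>i\<le>n. real_of_rat (coeff p i) * (real t ^ i / real t ^ n))"
        by (simp add: poly_altdef n_def of_rat_sum of_rat_mult of_rat_power sum_divide_distrib)
      also have "\<dots> = (\<Sum>i\<le>n. real_of_rat (coeff p i) * (1 / real t) ^ (n - i))"
      proof (intro sum.cong refl arg_cong[of _ _ "(*) _"])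
        fix i assume "i \<in> {..n}"
        then show "real t ^ i / real t ^ n = (1 / real t) ^ (n - i)"
          using elim by (simp add: power_diff power_one_over field_simps)
      qed
      finally show ?case by simp
    qed
    with * show ?thesis
      by (rule Lim_transform_eventually)
  qed
  have decay: "(\<lambda>t. ?f t / real t ^ j) \<longlonglongrightarrow> 0" if "i < j" "(\<lambda>t. ?f t / real t ^ i) \<longlonglongrightarrow> a" for i j a
  proof -
    have "(\<lambda>t. ?f t / real t ^ i * (1 / real t) ^ (j - i)) \<longlonglongrightarrow> a * 0"
      using that by (intro tendsto_mult inv_power) auto
    moreover have "?f t / real t ^ i * (1 / real t) ^ (j - i) = ?f t / real t ^ j" for t
    proof -
      have "real t ^ i * real t ^ (j - i) = real t ^ j"
        using that(1) by (simp flip: power_add)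
      then show ?thesis
        by (simp add: power_one_over flip: divide_divide_eq_left)
          (metis divide_divide_eq_left)
    qed
    ultimately show ?thesis by simp
  qed
  have "p \<noteq> 0"
  proof
    assume "p = 0"
    then show False
      using lim r LIMSEQ_unique[OF tendsto_const[of "0::real"], of r] by simp
  qed
  then have "\<not> m < n" "\<not> n < m"
    using decay[OF _ lim, of n] decay[OF _ lead, of m] LIMSEQ_unique lead lim r by fastforce+
  then have "m = n" by simp
  then show ?thesis
    using LIMSEQ_unique[OF lead] lim n_def by simp
qed

lemma rat_poly_zero_if_positive_nat_roots:
  fixes p :: "rat poly"
  assumes "\<And>t::nat. t > 0 \<Longrightarrow> poly p (of_nat t) = 0"
  shows "p = 0"
proof (rule ccontr)
  assume "p \<noteq> 0"
  then have "finite {x. poly p x = 0}"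
    by (rule poly_roots_finite)
  moreover have "(of_nat :: nat \<Rightarrow> rat) ` {0<..} \<subseteq> {x. poly p x = 0}"
    using assms by auto
  ultimately have "finite ((of_nat :: nat \<Rightarrow> rat) ` {0<..})"
    by (rule rev_finite_subset)
  then have "finite {0::nat<..}"
    by (rule finite_imageD) (simp add: inj_on_def)
  then show False
    by (simp add: infinite_Ioi)
qed

theorem theorem3p2:
  fixes P :: "(real ^ 'n) set" and c :: "real ^ 'n"
  assumes "lattice_polytope P"
  shows "(aff_dim P = int CARD('n) \<longrightarrow>
            (\<exists>p :: rat poly. (\<forall>t::nat. t > 0 \<longrightarrow> of_nat (lattice_count P c t) = poly p (of_nat t)) \<and>
               degree p = CARD('n) \<and> real_of_rat (lead_coeff p) = relvol P)) \<and>
         (\<exists>p :: rat poly. (\<forall>t::nat. t > 0 \<longrightarrow> of_nat (lattice_count P c t) = poly p (of_nat t)) \<and>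
            (p \<noteq> 0 \<longrightarrow> int (degree p) = aff_dim P \<and> real_of_rat (lead_coeff p) = relvol P))"
proof -
  obtain p :: "rat poly" where
    p: "\<And>t::nat. t > 0 \<Longrightarrow> of_nat (lattice_count P c t) = poly p (of_nat t)"
    using lattice_count_poly[OF assms] by blast
  obtain S where S: "finite S" "S \<subseteq> int_points" "P = convex hull S" "S \<noteq> {}"
    by (rule lattice_polytope_hull[OF assms])
  then obtain v where "v \<in> S"
    by blast
  then have v: "v \<in> P" "v \<in> int_points"
    using S by (auto intro: hull_inc)
  have dim_nonneg: "0 \<le> aff_dim P"
    using aff_dim_eq_dim[OF hull_inc[OF v(1)]] by simp
  \<comment> \<open>The two parts of the theorem differ only in how the integer point \<open>z\<close> is found.\<close>
  have leading: "degree p = nat (aff_dim P) \<and> real_of_rat (lead_coeff p) = relvol P"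
    if z: "z \<in> int_points" "z - c \<in> direction_space P" for z
  proof (rule rat_poly_growth)
    have "\<forall>\<^sub>F t in sequentially. real (lattice_count P c t) / real t ^ nat (aff_dim P) =
        real_of_rat (poly p (of_nat t)) / real t ^ nat (aff_dim P)"
      using eventually_gt_at_top[of 0]
      by eventually_elim (simp flip: p)
    with lattice_count_tendsto_relvol(1)[OF assms z]
    show "(\<lambda>t. real_of_rat (poly p (of_nat t)) / real t ^ nat (aff_dim P)) \<longlonglongrightarrow> relvol P"
      by (rule Lim_transform_eventually)
    show "relvol P \<noteq> 0"
      using lattice_count_tendsto_relvol(2)[OF assms z] by simp
  qed
  have "degree p = CARD('n) \<and> real_of_rat (lead_coeff p) = relvol P" if "aff_dim P = int CARD('n)"
  proof -
    have "affine hull P = UNIV"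
      using that aff_dim_eq_full[of P] by simp
    then have "direction_space P = UNIV"
      using direction_space_eq[of 0 P] by simp
    then show ?thesis
      using leading[of 0] that int_points_0 by simp
  qed
  moreover have "int (degree p) = aff_dim P \<and> real_of_rat (lead_coeff p) = relvol P" if "p \<noteq> 0"
  proof -
    have "\<not> (\<forall>t::nat. t > 0 \<longrightarrow> poly p (of_nat t) = 0)"
      using rat_poly_zero_if_positive_nat_roots[of p] that by auto
    then obtain t :: nat where t: "t > 0" "poly p (of_nat t) \<noteq> 0"
      by auto
    then have "lattice_count P c t \<noteq> 0"
      using p[of t] by auto
    then have "(\<lambda>x. c + real t *\<^sub>R x) ` P \<inter> int_points \<noteq> {}"
      unfolding lattice_count_def by force
    then obtain x where x: "x \<in> P" "c + real t *\<^sub>R x \<in> int_points"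
      by blast
    have v_aff: "v \<in> affine hull P" "x \<in> affine hull P"
      using v x by (auto intro: hull_inc)
    \<comment> \<open>Replacing \<open>x\<close> by the integral point \<open>v\<close> moves only within the direction space.\<close>
    define z where "z = c + real t *\<^sub>R x - real t *\<^sub>R v"
    have "z \<in> int_points"
      unfolding z_def using x(2) v(2) by (intro int_points_diff int_points_scaleR) auto
    moreover have "real t *\<^sub>R (x - v) \<in> direction_space P"
    proof (rule subspace_scale)
      show "subspace (direction_space P)"
        using v(1) by (intro subspace_direction_space) auto
      show "x - v \<in> direction_space P"
        unfolding direction_space_def using v_aff by blast
    qed
    then have "z - c \<in> direction_space P"
      by (simp add: z_def scaleR_diff_right)
    ultimately have "degree p = nat (aff_dim P) \<and> real_of_rat (lead_coeff p) = relvol P"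
      by (rule leading)
    then show ?thesis
      using dim_nonneg by (metis nat_0_le)
  qed
  ultimately show ?thesis
    using p by blast
qed

end
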